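(* Let $\{\pi_k\}_{k\ge0}$ and $\{V^{\pi_k}\}_{k\ge0}$ be the policy and value sequences generated by PMD with mirror map $h(p)=\sum_a\psi(p(a))$ and a constant step size $\eta>0$. If $\psi'(0^+)=-\infty$ and $\psi'(1^-)=+\infty$, then the sequence of value errors is summable, namely $\sum_{k=0}^\infty\|V^*-V^{\pi_k}\|_\infty<\infty$. Consequently, the policy sequence converges to an optimal policy $\pi_\infty$, i.e. $\lim_{k\to\infty}\pi_k=\pi_\infty\in\Pi^*$. Moreover, $\pi_\infty$ satisfies: (i) $\pi_\infty(a'|s)=0$ for all $s\in\mathcal S$ and $a'\notin\mathcal A_s^*$; (ii) $\pi_\infty(a^*|s)=1$ for all $s\in\mathcal S_{=1}$ and $a^*\in\mathcal A_s^*$; (iii) $\pi_\infty(a^*|s)\in\mathrm{int}\,\mathrm{dom}\,\psi$ for all $s\in\mathcal S_{>1}$ and $a^*\in\mathcal A_s^*$.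
   Context: MDP: $(\mathcal S,\mathcal A,P,r,\gamma)$ is a finite discounted Markov decision process: finite state space $\mathcal S$, finite action space $\mathcal A$, transition model $P(\cdot|s,a)\in\Delta(\mathcal S)$, reward $r:\mathcal S\times\mathcal A\to[0,1]$, discount $\gamma\in[0,1)$. $\Delta(\mathcal X)$ is the probability simplex over a finite set $\mathcal X$. A policy $\pi$ assigns to each $s$ a distribution $\pi(\cdot|s)\in\Delta(\mathcal A)$; $\Pi$ is the set of all policies. $V^\pi(s)$ is the expected value of $\sum_{t\ge0}\gamma^t r(s_t,a_t)$ given $s_0=s$, $a_t\sim\pi(\cdot|s_t)$, $s_{t+1}\sim P(\cdot|s_t,a_t)$, and $Q^\pi(s,a)$ is the same conditioned on $(s_0,a_0)=(s,a)$. $V^*(s)=\max_{\pi\in\Pi}V^\pi(s)$, $Q^*(s,a)=\max_{\pi\in\Pi}Q^\pi(s,a)$; $\Pi^*$ is the set of optimal policies ($V^\pi=V^*$). $\mathcal A^*_s=\{a: Q^*(s,a)=V^*(s)\}$, $\mathcal S_{=1}=\{s:|\mathcal A_s^*|=1\}$, $\mathcal S_{>1}=\{s:|\mathcal A_s^*|>1\}$, $\tilde{\mathcal S}=\{s:\mathcal A_s^*\ne\mathcal A\}$, the last assumed nonempty throughout. Mirror map: $\psi:\mathbb R\to(-\infty,+\infty]$ satisfies: (a) $\mathrm{dom}\,\psi\supseteq[0,1]$; (b) $\psi$ is proper, closed and convex; (c) $\psi$ is differentiable on $\mathrm{int}\,\mathrm{dom}\,\psi$ and $|\psi'(x_n)|\to\infty$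 for every sequence $\{x_n\}\subseteq\mathrm{int}\,\mathrm{dom}\,\psi$ converging to a boundary point of $\mathrm{dom}\,\psi$; (d) $\psi$ is strictly convex on $\mathrm{int}\,\mathrm{dom}\,\psi$. $\psi'(0^+)$ and $\psi'(1^-)$ are the one-sided limits of $\psi'$ at $0$ from the right and at $1$ from the left. $h(p)=\sum_{a\in\mathcal A}\psi(p(a))$ and $D_h(p\|q)=h(p)-h(q)-\langle\nabla h(q),p-q\rangle$. PMD: given $\eta>0$ and an initial policy $\pi_0$ with $\pi_0(a|s)\in\mathrm{int}\,\mathrm{dom}\,\psi$ for all $(s,a)$ (assumed throughout), for each $s$, $\pi_{k+1}(\cdot|s)=\arg\max_{p\in\Delta(\mathcal A)}\{\eta\langle p,Q^{\pi_k}(s,\cdot)\rangle-D_h(p\|\pi_k(\cdot|s))\}$; all iterates satisfy $\pi_k(a|s)\in\mathrm{int}\,\mathrm{dom}\,\psi$. *)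

theory Defs
  imports "HOL-Probability.Probability"
begin

text \<open>
  States and actions range over finite types \<open>'s\<close> and \<open>'a\<close>, a transition model is
  \<open>P :: 's \<Rightarrow> 'a \<Rightarrow> 's pmf\<close>, and \<open>'s \<Rightarrow> 'a pmf\<close> is the set of all policies.
\<close>

definition finite_discounted_mdp ::
    "('s::finite \<Rightarrow> 'a::finite \<Rightarrow> 's pmf) \<Rightarrow> ('s \<Rightarrow> 'a \<Rightarrow> real) \<Rightarrow> real \<Rightarrow> bool" where
  "finite_discounted_mdp P r \<gamma> \<longleftrightarrow> (\<forall>s a. r s a \<in> {0..1}) \<and> \<gamma> \<in> {0..<1}"

definition choose_action :: "('s \<Rightarrow> 'a pmf) \<Rightarrow> 's \<Rightarrow> ('s \<times> 'a) pmf" where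
  "choose_action \<pi> s = map_pmf (Pair s) (\<pi> s)"

text \<open>
  Kernel for time \<open>t\<close>, given the history \<open>\<omega> 0, \<dots>, \<omega> (t - 1)\<close> of state-action pairs:
  the pair at time 0 has law \<open>\<mu>\<close>; afterwards
  \<open>s\<^sub>t \<sim> P(\<cdot> | s\<^sub>t\<^sub>-\<^sub>1, a\<^sub>t\<^sub>-\<^sub>1)\<close> and \<open>a\<^sub>t \<sim> \<pi>(\<cdot> | s\<^sub>t)\<close>.
\<close>

definition mdp_kernel ::
    "('s \<Rightarrow> 'a \<Rightarrow> 's pmf) \<Rightarrow> ('s \<Rightarrow> 'a pmf) \<Rightarrow> ('s \<times> 'a) pmf \<Rightarrow>
     nat \<Rightarrow> (nat \<Rightarrow> 's \<times> 'a) \<Rightarrow> ('s \<times> 'a) measure" where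
  "mdp_kernel P \<pi> \<mu> t \<omega> =
     measure_pmf (if t = 0 then \<mu>
       else bind_pmf (P (fst (\<omega> (t - 1))) (snd (\<omega> (t - 1)))) (choose_action \<pi>))"

lemma Ionescu_Tulcea_mdp_kernel:
  fixes P :: "'s::finite \<Rightarrow> 'a::finite \<Rightarrow> 's pmf"
  shows "Ionescu_Tulcea (mdp_kernel P \<pi> \<mu>) (\<lambda>_. count_space UNIV)"
proof (rule Ionescu_Tulcea.intro, goal_cases)
  case (1 i)
  show "mdp_kernel P \<pi> \<mu> i
      \<in> measurable (PiM {0..<i} (\<lambda>_. count_space UNIV)) (subprob_algebra (count_space UNIV))"
  proof (cases i)
    case 0
    then show ?thesis
      unfolding mdp_kernel_def by (simp add: measure_pmf_in_subprob_algebra)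
  next
    case (Suc j)
    let ?f = "\<lambda>x. measure_pmf (bind_pmf (P (fst x) (snd x)) (choose_action \<pi>))"
    have "?f \<in> measurable (count_space UNIV) (subprob_algebra (count_space UNIV))"
      by (simp add: measure_pmf_in_subprob_algebra)
    moreover have "(\<lambda>\<omega>. \<omega> j) \<in>
        measurable (PiM {0..<i} (\<lambda>_. count_space (UNIV :: ('s \<times> 'a) set))) (count_space UNIV)"
      using Suc by (intro measurable_component_singleton) auto
    ultimately have "(\<lambda>\<omega>. ?f (\<omega> j)) \<in>
        measurable (PiM {0..<i} (\<lambda>_. count_space UNIV)) (subprob_algebra (count_space UNIV))"
      by (rule measurable_compose[rotated])
    then show ?thesis
      using Suc unfolding mdp_kernel_def by simp
  qed
next
  case (2 i \<omega>)
  show "prob_space (mdp_kernel P \<pi> \<mu> i \<omega>)"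
    by (simp only: mdp_kernel_def prob_space_measure_pmf)
qed

text \<open>The law of \<open>(s\<^sub>t, a\<^sub>t)\<close>, \<open>t \<ge> 0\<close>, on path space (Ionescu-Tulcea limit).\<close>

definition trajectory_measure ::
    "('s \<Rightarrow> 'a \<Rightarrow> 's pmf) \<Rightarrow> ('s \<Rightarrow> 'a pmf) \<Rightarrow> ('s \<times> 'a) pmf \<Rightarrow>
     (nat \<Rightarrow> 's \<times> 'a) measure" where
  "trajectory_measure P \<pi> \<mu> =
     projective_family.lim UNIV
       (Ionescu_Tulcea.CI (mdp_kernel P \<pi> \<mu>) (\<lambda>_. count_space UNIV)) (\<lambda>_. count_space UNIV)"

lemma prob_space_trajectory_measure:
  fixes P :: "'s::finite \<Rightarrow> 'a::finite \<Rightarrow> 's pmf"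
  shows "prob_space (trajectory_measure P \<pi> \<mu>)"
proof -
  interpret Ionescu_Tulcea "mdp_kernel P \<pi> \<mu>" "\<lambda>_. count_space UNIV"
    by (rule Ionescu_Tulcea_mdp_kernel)
  let ?M = "\<lambda>_. count_space (UNIV :: ('s \<times> 'a) set)"
  have meas: "(\<lambda>x. restrict x {}) \<in> measurable PF.lim (PiM {} ?M)"
    unfolding measurable_cong_sets[OF PF.sets_lim refl]
    by (rule measurable_restrict_subset[OF empty_subsetI])
  have "prob_space (distr PF.lim (PiM {} ?M) (\<lambda>x. restrict x {}))"
    unfolding distr_lim[OF finite.emptyI] by (rule PF.prob_space_P) simp_all
  then have "prob_space PF.lim"
    using meas by (rule prob_space_distrD[rotated])
  then show ?thesis
    unfolding trajectory_measure_def .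
qed

definition discounted_return ::
    "('s \<Rightarrow> 'a \<Rightarrow> real) \<Rightarrow> real \<Rightarrow> (nat \<Rightarrow> 's \<times> 'a) \<Rightarrow> real" where
  "discounted_return r \<gamma> \<omega> = (\<Sum>t. \<gamma> ^ t * r (fst (\<omega> t)) (snd (\<omega> t)))"

definition value_fun ::
    "('s \<Rightarrow> 'a \<Rightarrow> 's pmf) \<Rightarrow> ('s \<Rightarrow> 'a \<Rightarrow> real) \<Rightarrow> real \<Rightarrow> ('s \<Rightarrow> 'a pmf) \<Rightarrow> 's \<Rightarrow> real" where
  "value_fun P r \<gamma> \<pi> s =
     (\<integral>\<omega>. discounted_return r \<gamma> \<omega> \<partial>trajectory_measure P \<pi> (choose_action \<pi> s))"

text \<open>
  Conditioning on \<open>(s\<^sub>0, a\<^sub>0) = (s, a)\<close> means starting the process there, also when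
  \<open>\<pi>(a | s) = 0\<close>.
\<close>

definition q_fun ::
    "('s \<Rightarrow> 'a \<Rightarrow> 's pmf) \<Rightarrow> ('s \<Rightarrow> 'a \<Rightarrow> real) \<Rightarrow> real \<Rightarrow> ('s \<Rightarrow> 'a pmf) \<Rightarrow>
     's \<Rightarrow> 'a \<Rightarrow> real" where
  "q_fun P r \<gamma> \<pi> s a =
     (\<integral>\<omega>. discounted_return r \<gamma> \<omega> \<partial>trajectory_measure P \<pi> (return_pmf (s, a)))"

text \<open>
  The maxima over all policies; values lie in \<open>[0, 1/(1 - \<gamma>)]\<close> and the suprema are attained
  for a finite discounted MDP.
\<close>

definition opt_value ::
    "('s \<Rightarrow> 'a \<Rightarrow> 's pmf) \<Rightarrow> ('s \<Rightarrow> 'a \<Rightarrow> real) \<Rightarrow> real \<Rightarrow> 's \<Rightarrow> real" where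
  "opt_value P r \<gamma> s = (SUP \<pi>. value_fun P r \<gamma> \<pi> s)"

definition opt_q ::
    "('s \<Rightarrow> 'a \<Rightarrow> 's pmf) \<Rightarrow> ('s \<Rightarrow> 'a \<Rightarrow> real) \<Rightarrow> real \<Rightarrow> 's \<Rightarrow> 'a \<Rightarrow> real" where
  "opt_q P r \<gamma> s a = (SUP \<pi>. q_fun P r \<gamma> \<pi> s a)"

definition opt_policies ::
    "('s \<Rightarrow> 'a \<Rightarrow> 's pmf) \<Rightarrow> ('s \<Rightarrow> 'a \<Rightarrow> real) \<Rightarrow> real \<Rightarrow> ('s \<Rightarrow> 'a pmf) set" where
  "opt_policies P r \<gamma> = {\<pi>. value_fun P r \<gamma> \<pi> = opt_value P r \<gamma>}"

definition opt_actions ::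
    "('s \<Rightarrow> 'a \<Rightarrow> 's pmf) \<Rightarrow> ('s \<Rightarrow> 'a \<Rightarrow> real) \<Rightarrow> real \<Rightarrow> 's \<Rightarrow> 'a set" where
  "opt_actions P r \<gamma> s = {a. opt_q P r \<gamma> s a = opt_value P r \<gamma> s}"

definition states_unique_opt ::
    "('s \<Rightarrow> 'a \<Rightarrow> 's pmf) \<Rightarrow> ('s \<Rightarrow> 'a \<Rightarrow> real) \<Rightarrow> real \<Rightarrow> 's set" where
  "states_unique_opt P r \<gamma> = {s. card (opt_actions P r \<gamma> s) = 1}"

definition states_multiple_opt ::
    "('s \<Rightarrow> 'a \<Rightarrow> 's pmf) \<Rightarrow> ('s \<Rightarrow> 'a \<Rightarrow> real) \<Rightarrow> real \<Rightarrow> 's set" where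
  "states_multiple_opt P r \<gamma> = {s. card (opt_actions P r \<gamma> s) > 1}"

definition nontrivial_states ::
    "('s \<Rightarrow> 'a \<Rightarrow> 's pmf) \<Rightarrow> ('s \<Rightarrow> 'a \<Rightarrow> real) \<Rightarrow> real \<Rightarrow> 's set" where
  "nontrivial_states P r \<gamma> = {s. opt_actions P r \<gamma> s \<noteq> UNIV}"

definition sup_norm :: "('s::finite \<Rightarrow> real) \<Rightarrow> real" where
  "sup_norm f = Max (range (\<lambda>s. \<bar>f s\<bar>))"

definition eff_dom :: "('b \<Rightarrow> ereal) \<Rightarrow> 'b set" where
  "eff_dom f = {x. f x < \<infinity>}"

text \<open>The library's \<open>epigraph\<close> is only for real-valued functions.\<close>

definition ereal_epigraph :: "('b \<Rightarrow> ereal) \<Rightarrow> ('b \<times> real) set" where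
  "ereal_epigraph f = {(x, t). f x \<le> ereal t}"

definition ereal_deriv :: "(real \<Rightarrow> ereal) \<Rightarrow> real \<Rightarrow> real" where
  "ereal_deriv \<psi> = deriv (\<lambda>x. real_of_ereal (\<psi> x))"

definition mirror_map :: "(real \<Rightarrow> ereal) \<Rightarrow> bool" where
  "mirror_map \<psi> \<longleftrightarrow>
     {0..1} \<subseteq> eff_dom \<psi> \<and>
     (\<forall>x. \<psi> x \<noteq> - \<infinity>) \<and> eff_dom \<psi> \<noteq> {} \<and>
     closed (ereal_epigraph \<psi>) \<and> convex (ereal_epigraph \<psi>) \<and>
     (\<forall>x\<in>interior (eff_dom \<psi>). (\<lambda>y. real_of_ereal (\<psi> y)) differentiable (at x)) \<and>
     (\<forall>X x. (\<forall>n. X n \<in> interior (eff_dom \<psi>)) \<and> X \<longlonglongrightarrow> x \<and> x \<in> frontier (eff_dom \<psi>) \<longrightarrow>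
        filterlim (\<lambda>n. \<bar>ereal_deriv \<psi> (X n)\<bar>) at_top sequentially) \<and>
     (\<forall>x\<in>interior (eff_dom \<psi>). \<forall>y\<in>interior (eff_dom \<psi>). \<forall>u. x \<noteq> y \<and> 0 < u \<and> u < 1 \<longrightarrow>
        \<psi> ((1 - u) * x + u * y) < ereal (1 - u) * \<psi> x + ereal u * \<psi> y)"

definition separable :: "(real \<Rightarrow> ereal) \<Rightarrow> real ^ 'a::finite \<Rightarrow> ereal" where
  "separable \<psi> p = (\<Sum>a\<in>UNIV. \<psi> (p $ a))"

definition gradient :: "('b::real_inner \<Rightarrow> real) \<Rightarrow> 'b \<Rightarrow> 'b" where
  "gradient f x = (THE D. GDERIV f x :> D)"

definition bregman :: "('b::real_inner \<Rightarrow> ereal) \<Rightarrow> 'b \<Rightarrow> 'b \<Rightarrow> ereal" where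
  "bregman f p q = f p - f q - ereal (gradient (\<lambda>x. real_of_ereal (f x)) q \<bullet> (p - q))"

definition prob_vec :: "'a::finite pmf \<Rightarrow> real ^ 'a" where
  "prob_vec p = (\<chi> a. pmf p a)"

definition pmd_iterates ::
    "('s::finite \<Rightarrow> 'a::finite \<Rightarrow> 's pmf) \<Rightarrow> ('s \<Rightarrow> 'a \<Rightarrow> real) \<Rightarrow> real \<Rightarrow>
     (real \<Rightarrow> ereal) \<Rightarrow> real \<Rightarrow> (nat \<Rightarrow> 's \<Rightarrow> 'a pmf) \<Rightarrow> bool" where
  "pmd_iterates P r \<gamma> \<psi> \<eta> \<pi> \<longleftrightarrow>
     (\<forall>k s. is_arg_max
        (\<lambda>p. ereal (\<eta> * (prob_vec p \<bullet> (\<chi> a. q_fun P r \<gamma> (\<pi> k) s a)))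
               - bregman (separable \<psi>) (prob_vec p) (prob_vec (\<pi> k s)))
        (\<lambda>_. True) (\<pi> (Suc k) s))"

end

theory Submission
  imports Defs
begin

text \<open>
  Write \<open>g\<close> for the derivative of \<open>\<psi>\<close>. Since \<open>g\<close> is strictly increasing and blows up at \<open>0\<close> and \<open>1\<close>, the
  interior of the domain of \<open>\<psi>\<close> is exactly \<open>(0,1)\<close>, and a mirror step started in the interior stays there:
  raising a vanishing probability would have infinite marginal benefit. Its optimality condition is that
  \<open>\<eta> * Q\<^sup>k(s,a) + g (\<pi>\<^sub>k(a|s)) - g (\<pi>\<^sub>k\<^sub>+\<^sub>1(a|s))\<close> does not depend on the action \<open>a\<close>
  (\<open>mirror_step_optimality\<close>). Both halves of the theorem are read off from this.

  Value errors. The condition and the three-point identity for the Bregman divergence \<open>D\<close> yield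
  \<open>\<eta> * \<langle>\<rho> - \<pi>\<^sub>k\<^sub>+\<^sub>1, Q\<^sup>k\<rangle> = D \<rho> \<pi>\<^sub>k - D \<rho> \<pi>\<^sub>k\<^sub>+\<^sub>1 - D \<pi>\<^sub>k\<^sub>+\<^sub>1 \<pi>\<^sub>k\<close> for every policy \<open>\<rho>\<close>
  (\<open>mirror_step_gain\<close>). For \<open>\<rho> = \<pi>\<^sub>k\<close> this is policy improvement; for an optimal \<open>\<rho>\<close> it bounds the regret by
  a telescoping difference. Writing \<open>\<delta>\<^sub>k\<close> for the value error, \<open>\<delta>\<^sub>k - \<gamma> P\<^sub>\<rho> \<delta>\<^sub>k\<close> is at most this difference
  (divided by \<open>\<eta>\<close>) plus \<open>\<delta>\<^sub>k - \<delta>\<^sub>k\<^sub>+\<^sub>1\<close>, so \<open>S - \<gamma> P\<^sub>\<rho> S\<close> has one upper bound for all partial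
  sums \<open>S\<close> of the errors. Looking at a state where \<open>S\<close> is maximal bounds \<open>S\<close> itself (\<open>summable_value_errors\<close>).

  Policies. By the optimality condition, the gap \<open>g (\<pi>\<^sub>k(a|s)) - g (\<pi>\<^sub>k(b|s))\<close> accumulates
  \<open>\<eta> * (Q\<^sup>k(s,a) - Q\<^sup>k(s,b))\<close>. Between two optimal actions these increments are bounded by the summable
  value errors, so the gap converges; if \<open>b\<close> is optimal and \<open>a\<close> is not, the gap tends to \<open>-\<infinity>\<close>. Hence
  suboptimal actions die out, and the limiting gaps together with total mass 1 determine the remaining
  probabilities, all of them positive (\<open>policy_sequence_converges\<close>). A policy supported on optimal actions
  is optimal.

  The values in the statement are integrals over path space; the Bellman equations, by which alone they
  enter the argument, follow from the one-time marginals of the Ionescu-Tulcea measure.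
\<close>

section \<open>Values as series and the Bellman equations\<close>

primrec pair_law ::
    "('s \<Rightarrow> 'a \<Rightarrow> 's pmf) \<Rightarrow> ('s \<Rightarrow> 'a pmf) \<Rightarrow> ('s \<times> 'a) pmf \<Rightarrow> nat \<Rightarrow> ('s \<times> 'a) pmf" where
  "pair_law P \<pi> \<mu> 0 = \<mu>"
| "pair_law P \<pi> \<mu> (Suc t) =
     bind_pmf (pair_law P \<pi> \<mu> t) (\<lambda>x. bind_pmf (P (fst x) (snd x)) (choose_action \<pi>))"

text \<open>
  Up to time \<open>t\<close> the projective limit is the finite Ionescu-Tulcea composition \<open>C 0 (Suc t)\<close>, whose last
  factor is the kernel at time \<open>t\<close>. That kernel looks only at the preceding pair, so the one-time
  marginals form a Markov chain and are finite distributions.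
\<close>

lemma distr_trajectory_measure:
  fixes P :: "'s::finite \<Rightarrow> 'a::finite \<Rightarrow> 's pmf"
  shows "distr (trajectory_measure P \<pi> \<mu>) (count_space UNIV) (\<lambda>\<omega>. \<omega> t)
           = measure_pmf (pair_law P \<pi> \<mu> t)"
proof -
  interpret Ionescu_Tulcea "mdp_kernel P \<pi> \<mu>" "\<lambda>_. count_space UNIV"
    by (rule Ionescu_Tulcea_mdp_kernel)
  let ?M = "\<lambda>_::nat. count_space (UNIV :: ('s \<times> 'a) set)"
  let ?u = "\<lambda>_::nat. undefined :: 's \<times> 'a"
  let ?N = "\<lambda>x. measure_pmf (bind_pmf (P (fst x) (snd x)) (choose_action \<pi>))"
  have u: "?u \<in> space (PiM {0..<0} ?M)" by (simp add: space_PiM)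
  have coord: "(\<lambda>\<omega>. \<omega> i) \<in> measurable (PiM J ?M) (count_space UNIV)" if "i \<in> J" for i J
    using that by (rule measurable_component_singleton)
  have C_sets: "measurable (C 0 n ?u) K = measurable (PiM {0..<n} ?M) K" for n and K :: "'z measure"
    using sets_C[OF u, of n] by (intro measurable_cong_sets) auto
  have C_space: "space (C 0 n ?u) = space (PiM {0..<n} ?M)" for n
    using space_C[OF u, of n] by simp
  have C_ne: "space (C 0 n ?u) \<noteq> {}" for n
    by (rule prob_space.not_empty[OF prob_space_C[OF u]])
  \<comment> \<open>The last coordinate is drawn from the kernel, whatever the history.\<close>
  have step: "distr (C 0 (Suc n) ?u) (count_space UNIV) (\<lambda>\<omega>. \<omega> n)
      = C 0 n ?u \<bind> mdp_kernel P \<pi> \<mu> n" for n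
  proof -
    have "distr (C 0 (Suc n) ?u) (count_space UNIV) (\<lambda>\<omega>. \<omega> n)
        = C 0 n ?u \<bind> (\<lambda>x. distr (eP n x) (count_space UNIV) (\<lambda>\<omega>. \<omega> n))"
      using measurable_eP[of n] C_ne[of n]
      by (simp, intro distr_bind[where K = "PiM {0..<Suc n} ?M"])
         (auto simp: C_sets intro!: coord)
    also have "\<dots> = C 0 n ?u \<bind> mdp_kernel P \<pi> \<mu> n"
    proof (rule bind_cong[OF refl])
      fix x assume "x \<in> space (C 0 n ?u)"
      then have x: "x \<in> space (PiM {0..<n} ?M)" by (simp add: C_space)
      have "fun_upd x n \<in> measurable (mdp_kernel P \<pi> \<mu> n x) (PiM {0..<Suc n} ?M)"
        using x by (intro measurable_fun_upd[where J="{0..<n}"])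
          (auto intro!: measurable_ident_sets sets_P)
      then have "distr (eP n x) (count_space UNIV) (\<lambda>\<omega>. \<omega> n)
          = distr (mdp_kernel P \<pi> \<mu> n x) (count_space UNIV) ((\<lambda>\<omega>. \<omega> n) \<circ> fun_upd x n)"
        unfolding eP_def by (intro distr_distr coord) auto
      also have "\<dots> = mdp_kernel P \<pi> \<mu> n x"
        using sets_P[OF x] by (simp add: comp_def distr_id2)
      finally show "distr (eP n x) (count_space UNIV) (\<lambda>\<omega>. \<omega> n) = mdp_kernel P \<pi> \<mu> n x" .
    qed
    finally show ?thesis .
  qed
  have C_law: "distr (C 0 (Suc n) ?u) (count_space UNIV) (\<lambda>\<omega>. \<omega> n)
      = measure_pmf (pair_law P \<pi> \<mu> n)" for n
  proof (induction n)
    case 0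
    show ?case
      unfolding step using u P[of 0]
      by (simp add: bind_return[where N="count_space UNIV"] mdp_kernel_def)
  next
    case (Suc n)
    have "C 0 (Suc n) ?u \<bind> mdp_kernel P \<pi> \<mu> (Suc n)
        = C 0 (Suc n) ?u \<bind> (\<lambda>\<omega>. ?N (\<omega> n))"
      by (rule bind_cong) (auto simp: mdp_kernel_def)
    also have "\<dots> = distr (C 0 (Suc n) ?u) (count_space UNIV) (\<lambda>\<omega>. \<omega> n) \<bind> ?N"
      using C_ne[of "Suc n"]
      by (intro bind_distr[symmetric, where K="count_space UNIV"])
         (auto simp: C_sets measure_pmf_in_subprob_algebra simp del: C.simps intro!: coord)
    also have "\<dots> = measure_pmf (pair_law P \<pi> \<mu> (Suc n))"
      unfolding Suc by (simp add: measure_pmf_bind)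
    finally show ?case unfolding step .
  qed
  have up: "up_to {t} = Suc t"
    by (intro antisym) (auto simp: up_to_iff Suc_le_eq up_to_less)
  have "distr PF.lim (count_space UNIV) (\<lambda>\<omega>. \<omega> t)
      = distr PF.lim (count_space UNIV) ((\<lambda>\<omega>. \<omega> t) \<circ> (\<lambda>x. restrict x {t}))"
    by (intro distr_cong) auto
  also have "\<dots> = distr (distr PF.lim (PiM {t} ?M) (\<lambda>x. restrict x {t})) (count_space UNIV) (\<lambda>\<omega>. \<omega> t)"
    by (intro distr_distr[symmetric] coord)
       (auto simp: measurable_cong_sets[OF PF.sets_lim refl] intro!: measurable_restrict coord)
  also have "\<dots> = distr (CI {t}) (count_space UNIV) (\<lambda>\<omega>. \<omega> t)"
    by (simp add: distr_lim)
  also have "\<dots> = distr (C 0 (Suc t) ?u) (count_space UNIV) ((\<lambda>\<omega>. \<omega> t) \<circ> (\<lambda>x. restrict x {t}))"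
    unfolding CI_def up
    by (intro distr_distr coord) (auto simp: C_sets simp del: C.simps intro!: measurable_restrict coord)
  also have "\<dots> = distr (C 0 (Suc t) ?u) (count_space UNIV) (\<lambda>\<omega>. \<omega> t)"
    by (intro distr_cong) auto
  finally show ?thesis
    unfolding C_law trajectory_measure_def .
qed

lemma measurable_trajectory_coordinate:
  fixes P :: "'s::finite \<Rightarrow> 'a::finite \<Rightarrow> 's pmf"
  shows "(\<lambda>\<omega>. \<omega> t) \<in> measurable (trajectory_measure P \<pi> \<mu>) (count_space UNIV)"
proof -
  interpret Ionescu_Tulcea "mdp_kernel P \<pi> \<mu>" "\<lambda>_. count_space UNIV"
    by (rule Ionescu_Tulcea_mdp_kernel)
  show ?thesis
    unfolding trajectory_measure_def measurable_cong_sets[OF PF.sets_lim refl]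
    by (rule measurable_component_singleton) simp
qed

lemma expectation_trajectory:
  fixes P :: "'s::finite \<Rightarrow> 'a::finite \<Rightarrow> 's pmf" and f :: "'s \<times> 'a \<Rightarrow> real"
  shows "integrable (trajectory_measure P \<pi> \<mu>) (\<lambda>\<omega>. f (\<omega> t))"
    and "(\<integral>\<omega>. f (\<omega> t) \<partial>trajectory_measure P \<pi> \<mu>) = measure_pmf.expectation (pair_law P \<pi> \<mu> t) f"
proof -
  have "integrable (distr (trajectory_measure P \<pi> \<mu>) (count_space UNIV) (\<lambda>\<omega>. \<omega> t)) f"
    unfolding distr_trajectory_measure by (rule integrable_measure_pmf_finite) simp
  then show "integrable (trajectory_measure P \<pi> \<mu>) (\<lambda>\<omega>. f (\<omega> t))"
    by (simp add: integrable_distr_eq measurable_trajectory_coordinate)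
  show "(\<integral>\<omega>. f (\<omega> t) \<partial>trajectory_measure P \<pi> \<mu>) = measure_pmf.expectation (pair_law P \<pi> \<mu> t) f"
    by (simp add: distr_trajectory_measure[symmetric] integral_distr measurable_trajectory_coordinate)
qed

text \<open>
  The rewards are bounded by 1 and the discount is below 1, so the expectation may be exchanged with the
  series, and a value becomes a discounted series of expectations under the one-time marginals.
\<close>

lemma expected_return_sums:
  fixes P :: "'s::finite \<Rightarrow> 'a::finite \<Rightarrow> 's pmf"
  assumes "finite_discounted_mdp P r \<gamma>"
  shows "(\<lambda>t. \<gamma> ^ t * measure_pmf.expectation (pair_law P \<pi> \<mu> t) (\<lambda>x. r (fst x) (snd x)))
           sums (\<integral>\<omega>. discounted_return r \<gamma> \<omega> \<partial>trajectory_measure P \<pi> \<mu>)"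
proof -
  let ?T = "trajectory_measure P \<pi> \<mu>"
  let ?f = "\<lambda>t \<omega>. \<gamma> ^ t * r (fst (\<omega> t)) (snd (\<omega> t))"
  interpret prob_space ?T by (rule prob_space_trajectory_measure)
  have r: "\<bar>r s a\<bar> \<le> 1" and \<gamma>: "0 \<le> \<gamma>" "\<gamma> < 1" for s a
    using assms by (auto simp: finite_discounted_mdp_def abs_le_iff)
  have bound: "norm (?f t \<omega>) \<le> \<gamma> ^ t" for t \<omega>
    using r \<gamma> by (simp add: abs_mult mult_left_le)
  have geo: "summable (\<lambda>t. \<gamma> ^ t)"
    using \<gamma> by (intro summable_geometric) auto
  have int: "integrable ?T (?f t)" for t
    using expectation_trajectory(1)[where f="\<lambda>x. \<gamma> ^ t * r (fst x) (snd x)"] .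
  have "(\<integral>\<omega>. norm (?f t \<omega>) \<partial>?T) \<le> \<gamma> ^ t" for t
    using bound int by (intro integral_le_const) auto
  then have sum: "summable (\<lambda>t. \<integral>\<omega>. norm (?f t \<omega>) \<partial>?T)"
    by (intro summable_comparison_test'[OF geo, where N=0]) (simp add: integral_nonneg_AE)
  have abs: "AE \<omega> in ?T. summable (\<lambda>t. norm (?f t \<omega>))"
    using bound by (intro AE_I2 summable_comparison_test'[OF geo, where N=0]) simp
  have "(\<lambda>t. integral\<^sup>L ?T (?f t)) sums (\<integral>\<omega>. (\<Sum>t. ?f t \<omega>) \<partial>?T)"
    by (rule sums_integral[OF int abs sum])
  then show ?thesis
    using expectation_trajectory(2)[where f="\<lambda>x. r (fst x) (snd x)", of P \<pi> \<mu>]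
    by (simp add: discounted_return_def)
qed

lemma pair_law_bind:
  "pair_law P \<pi> (bind_pmf \<mu> f) t = bind_pmf \<mu> (\<lambda>x. pair_law P \<pi> (f x) t)"
  by (induction t) (simp_all add: bind_assoc_pmf)

text \<open>
  Time homogeneity: running the chain for one step first and then for \<open>t\<close> more steps. The recursion in
  \<open>pair_law\<close> adds its step at the other end.
\<close>

lemma pair_law_Suc:
  "pair_law P \<pi> \<mu> (Suc t)
     = pair_law P \<pi> (bind_pmf \<mu> (\<lambda>x. bind_pmf (P (fst x) (snd x)) (choose_action \<pi>))) t"
  by (induction t) simp_all

lemma expectation_bind_pmf_finite:
  fixes p :: "'b::finite pmf" and f :: "'b \<Rightarrow> 'c::finite pmf" and h :: "'c \<Rightarrow> real"
  shows "measure_pmf.expectation (bind_pmf p f) h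
           = (\<Sum>x\<in>UNIV. pmf p x * measure_pmf.expectation (f x) h)"
  by (subst pmf_expectation_bind[of UNIV]) auto

text \<open>
  The expected return is affine in the initial law. Applied to the law of the first action this relates
  \<open>V\<close> to \<open>Q\<close>, and applied to the law of the next state it gives the recursive half of the Bellman equation.
\<close>

lemma expected_return_bind:
  fixes P :: "'s::finite \<Rightarrow> 'a::finite \<Rightarrow> 's pmf" and \<mu> :: "'c::finite pmf"
  assumes "finite_discounted_mdp P r \<gamma>"
  shows "(\<integral>\<omega>. discounted_return r \<gamma> \<omega> \<partial>trajectory_measure P \<pi> (bind_pmf \<mu> f))
           = (\<Sum>x\<in>UNIV. pmf \<mu> x * (\<integral>\<omega>. discounted_return r \<gamma> \<omega> \<partial>trajectory_measure P \<pi> (f x)))"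
proof -
  let ?E = "\<lambda>\<mu> t. measure_pmf.expectation (pair_law P \<pi> \<mu> t) (\<lambda>x. r (fst x) (snd x))"
  have "(\<lambda>t. \<Sum>x\<in>UNIV. pmf \<mu> x * (\<gamma> ^ t * ?E (f x) t)) sums
      (\<Sum>x\<in>UNIV. pmf \<mu> x * (\<integral>\<omega>. discounted_return r \<gamma> \<omega> \<partial>trajectory_measure P \<pi> (f x)))"
    by (intro sums_sum sums_mult expected_return_sums assms)
  moreover have "(\<Sum>x\<in>UNIV. pmf \<mu> x * (\<gamma> ^ t * ?E (f x) t)) = \<gamma> ^ t * ?E (bind_pmf \<mu> f) t" for t
    by (simp add: pair_law_bind expectation_bind_pmf_finite sum_distrib_left mult_ac)
  ultimately show ?thesis
    using expected_return_sums[OF assms, of \<pi> "bind_pmf \<mu> f"] by (simp add: sums_unique2)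
qed

definition bellman_backup ::
    "('s::finite \<Rightarrow> 'a \<Rightarrow> 's pmf) \<Rightarrow> ('s \<Rightarrow> 'a \<Rightarrow> real) \<Rightarrow> real \<Rightarrow> ('s \<Rightarrow> real) \<Rightarrow> 's \<Rightarrow> 'a \<Rightarrow> real" where
  "bellman_backup P r \<gamma> v s a = r s a + \<gamma> * (\<Sum>s'\<in>UNIV. pmf (P s a) s' * v s')"

lemma value_fun_eq_expected_q:
  fixes P :: "'s::finite \<Rightarrow> 'a::finite \<Rightarrow> 's pmf"
  assumes "finite_discounted_mdp P r \<gamma>"
  shows "value_fun P r \<gamma> \<pi> s = (\<Sum>a\<in>UNIV. pmf (\<pi> s) a * q_fun P r \<gamma> \<pi> s a)"
  using expected_return_bind[OF assms, of \<pi> "\<pi> s" "\<lambda>a. return_pmf (s, a)"]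
  by (simp add: value_fun_def q_fun_def choose_action_def map_pmf_def)

lemma q_fun_eq_backup:
  fixes P :: "'s::finite \<Rightarrow> 'a::finite \<Rightarrow> 's pmf"
  assumes "finite_discounted_mdp P r \<gamma>"
  shows "q_fun P r \<gamma> \<pi> s a = bellman_backup P r \<gamma> (value_fun P r \<gamma> \<pi>) s a"
proof -
  let ?E = "\<lambda>\<mu> t. measure_pmf.expectation (pair_law P \<pi> \<mu> t) (\<lambda>x. r (fst x) (snd x))"
  let ?R = "\<lambda>\<mu>. \<integral>\<omega>. discounted_return r \<gamma> \<omega> \<partial>trajectory_measure P \<pi> \<mu>"
  let ?\<nu> = "bind_pmf (P s a) (choose_action \<pi>)"
  have "(\<lambda>t. \<gamma> * (\<gamma> ^ t * ?E ?\<nu> t)) sums (\<gamma> * ?R ?\<nu>)"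
    by (intro sums_mult expected_return_sums assms)
  moreover have "?E (return_pmf (s, a)) (Suc t) = ?E ?\<nu> t" for t
    unfolding pair_law_Suc by (simp add: bind_return_pmf)
  ultimately have "(\<lambda>t. \<gamma> ^ Suc t * ?E (return_pmf (s, a)) (Suc t)) sums (\<gamma> * ?R ?\<nu>)"
    by (simp add: mult.assoc)
  then have "(\<lambda>t. \<gamma> ^ t * ?E (return_pmf (s, a)) t) sums (\<gamma> * ?R ?\<nu> + r s a)"
    by (subst (asm) sums_Suc_iff) (simp add: algebra_simps)
  then have "?R (return_pmf (s, a)) = \<gamma> * ?R ?\<nu> + r s a"
    using expected_return_sums[OF assms] sums_unique2 by blast
  then show ?thesis
    by (simp add: q_fun_def bellman_backup_def expected_return_bind[OF assms] value_fun_def)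
qed

section \<open>Optimal values and policies\<close>

definition policy_backup ::
    "('s::finite \<Rightarrow> 'a::finite \<Rightarrow> 's pmf) \<Rightarrow> ('s \<Rightarrow> 'a \<Rightarrow> real) \<Rightarrow> real \<Rightarrow> ('s \<Rightarrow> 'a pmf) \<Rightarrow>
     ('s \<Rightarrow> real) \<Rightarrow> 's \<Rightarrow> real" where
  "policy_backup P r \<gamma> \<pi> v s = (\<Sum>a\<in>UNIV. pmf (\<pi> s) a * bellman_backup P r \<gamma> v s a)"

definition policy_transition ::
    "('s::finite \<Rightarrow> 'a::finite \<Rightarrow> 's pmf) \<Rightarrow> ('s \<Rightarrow> 'a pmf) \<Rightarrow> ('s \<Rightarrow> real) \<Rightarrow> 's \<Rightarrow> real" where
  "policy_transition P \<pi> u s = (\<Sum>a\<in>UNIV. pmf (\<pi> s) a * (\<Sum>s'\<in>UNIV. pmf (P s a) s' * u s'))"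

lemma sum_pmf_UNIV: "(\<Sum>x\<in>UNIV. pmf p x) = 1" for p :: "'b::finite pmf"
  by (rule sum_pmf_eq_1) auto

lemma pmf_average_le:
  fixes p :: "'b::finite pmf"
  assumes "\<And>x. f x \<le> m"
  shows "(\<Sum>x\<in>UNIV. pmf p x * f x) \<le> m"
proof -
  have "(\<Sum>x\<in>UNIV. pmf p x * f x) \<le> (\<Sum>x\<in>UNIV. pmf p x * m)"
    by (intro sum_mono mult_left_mono assms) simp
  then show ?thesis by (simp add: sum_distrib_right[symmetric] sum_pmf_UNIV)
qed

lemma attains_max_on_finite_type:
  fixes f :: "'b::finite \<Rightarrow> real"
  obtains x where "\<And>y. f y \<le> f x"
proof -
  have "Max (range f) \<in> range f" by (rule Max_in) auto
  then obtain x where x: "Max (range f) = f x" by (rule imageE)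
  have "f y \<le> f x" for y unfolding x[symmetric] by simp
  then show ?thesis by (rule that)
qed

text \<open>
  At a maximum of \<open>u\<close> the average \<open>policy_transition P \<pi> u\<close> is at most \<open>u\<close> itself. All the comparison and
  uniqueness statements about values below follow from this, and so does the bound on the accumulated value
  error, where it replaces the usual weighting with the occupancy measure of an optimal policy.
\<close>

lemma discounted_maximum_principle:
  assumes \<gamma>: "0 \<le> \<gamma>" "\<gamma> < 1"
    and u: "\<And>s. u s \<le> c + \<gamma> * policy_transition P \<pi> u s"
  shows "u s \<le> c / (1 - \<gamma>)"
proof -
  obtain s0 where le: "\<And>s'. u s' \<le> u s0"
    using attains_max_on_finite_type[of u] by blast
  have "policy_transition P \<pi> u s0 \<le> u s0"
    unfolding policy_transition_def by (intro pmf_average_le le)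
  then have "u s0 \<le> c + \<gamma> * u s0"
    using u[of s0] mult_left_mono[OF _ \<gamma>(1)] by fastforce
  then have "u s0 \<le> c / (1 - \<gamma>)"
    using \<gamma> by (simp add: field_simps)
  then show ?thesis using le[of s] by simp
qed

lemma bellman_backup_mono:
  assumes "0 \<le> \<gamma>" "\<And>s. v s \<le> w s"
  shows "bellman_backup P r \<gamma> v s a \<le> bellman_backup P r \<gamma> w s a"
  unfolding bellman_backup_def using assms
  by (intro add_left_mono mult_left_mono sum_mono) auto

lemma bellman_backup_diff_le:
  assumes "0 \<le> \<gamma>" "\<gamma> \<le> 1" "\<And>s. v s - w s \<le> m" "0 \<le> m"
  shows "bellman_backup P r \<gamma> v s a - bellman_backup P r \<gamma> w s a \<le> m"
proof -
  have "bellman_backup P r \<gamma> v s a - bellman_backup P r \<gamma> w s a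
      = \<gamma> * (\<Sum>s'\<in>UNIV. pmf (P s a) s' * (v s' - w s'))"
    by (simp add: bellman_backup_def right_diff_distrib sum_subtractf)
  also have "\<dots> \<le> \<gamma> * m"
    by (intro mult_left_mono pmf_average_le assms)
  also have "\<dots> \<le> m"
    using assms by (simp add: mult_left_le_one_le)
  finally show ?thesis .
qed

lemma policy_backup_mono:
  assumes "0 \<le> \<gamma>" "\<And>s. v s \<le> w s"
  shows "policy_backup P r \<gamma> \<pi> v s \<le> policy_backup P r \<gamma> \<pi> w s"
  unfolding policy_backup_def using assms
  by (intro sum_mono mult_left_mono bellman_backup_mono) auto

lemma policy_backup_diff:
  "policy_backup P r \<gamma> \<pi> v s - policy_backup P r \<gamma> \<pi> w s
     = \<gamma> * policy_transition P \<pi> (\<lambda>s'. v s' - w s') s"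
  by (simp add: policy_backup_def policy_transition_def bellman_backup_def sum_subtractf[symmetric]
      sum_distrib_left algebra_simps)

lemma policy_backup_return_pmf:
  "policy_backup P r \<gamma> (\<lambda>s. return_pmf (d s)) v s = bellman_backup P r \<gamma> v s (d s)"
  unfolding policy_backup_def by (subst sum.remove[of _ "d s"]) (auto intro!: sum.neutral)

lemma abs_le_sup_norm: "\<bar>f s\<bar> \<le> sup_norm f"
  by (simp add: sup_norm_def)

locale discounted_mdp =
  fixes P :: "'s::finite \<Rightarrow> 'a::finite \<Rightarrow> 's pmf" and r :: "'s \<Rightarrow> 'a \<Rightarrow> real" and \<gamma> :: real
  assumes mdp: "finite_discounted_mdp P r \<gamma>"
begin

lemma discount: "0 \<le> \<gamma>" "\<gamma> < 1"
  using mdp by (auto simp: finite_discounted_mdp_def)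

lemma value_fun_fixpoint: "value_fun P r \<gamma> \<pi> s = policy_backup P r \<gamma> \<pi> (value_fun P r \<gamma> \<pi>) s"
  unfolding policy_backup_def
  by (subst value_fun_eq_expected_q[OF mdp]) (simp add: q_fun_eq_backup[OF mdp])

lemma value_fun_le:
  assumes "\<And>s. policy_backup P r \<gamma> \<pi> w s \<le> w s"
  shows "value_fun P r \<gamma> \<pi> s \<le> w s"
proof -
  have "value_fun P r \<gamma> \<pi> s - w s
      \<le> 0 + \<gamma> * policy_transition P \<pi> (\<lambda>s. value_fun P r \<gamma> \<pi> s - w s) s" for s
    using assms[of s] value_fun_fixpoint[of \<pi> s]
      policy_backup_diff[of P r \<gamma> \<pi> "value_fun P r \<gamma> \<pi>" s w]
    by linarith
  from discounted_maximum_principle[OF discount this] show ?thesis by simp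
qed

lemma le_value_fun:
  assumes "\<And>s. w s \<le> policy_backup P r \<gamma> \<pi> w s"
  shows "w s \<le> value_fun P r \<gamma> \<pi> s"
proof -
  have "w s - value_fun P r \<gamma> \<pi> s
      \<le> 0 + \<gamma> * policy_transition P \<pi> (\<lambda>s. w s - value_fun P r \<gamma> \<pi> s) s" for s
    using assms[of s] value_fun_fixpoint[of \<pi> s]
      policy_backup_diff[of P r \<gamma> \<pi> w s "value_fun P r \<gamma> \<pi>"]
    by linarith
  from discounted_maximum_principle[OF discount this] show ?thesis by simp
qed

text \<open>
  There are finitely many deterministic policies; take one that maximises the sum of its values over all
  states. If some action beat it, switching to this action in that single state would raise the sum.
\<close>

lemma exists_unimprovable_deterministic_policy:
  obtains d where "\<And>s a. q_fun P r \<gamma> (\<lambda>s. return_pmf (d s)) s a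
                       \<le> value_fun P r \<gamma> (\<lambda>s. return_pmf (d s)) s"
proof -
  let ?V = "\<lambda>d. value_fun P r \<gamma> (\<lambda>s. return_pmf (d s :: 'a))"
  let ?F = "\<lambda>d. \<Sum>s\<in>UNIV. ?V d s"
  obtain d where max: "\<And>d'. ?F d' \<le> ?F d"
    using attains_max_on_finite_type[of ?F] by blast
  have "q_fun P r \<gamma> (\<lambda>s. return_pmf (d s)) s a \<le> ?V d s" for s a
  proof (rule ccontr)
    assume "\<not> ?thesis"
    then have less: "?V d s < bellman_backup P r \<gamma> (?V d) s a"
      by (simp add: q_fun_eq_backup[OF mdp])
    let ?d = "d(s := a)"
    have V: "?V d t = bellman_backup P r \<gamma> (?V d) t (d t)" for t
      using value_fun_fixpoint[of "\<lambda>s. return_pmf (d s)" t] by (simp add: policy_backup_return_pmf)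
    have le: "?V d t \<le> ?V ?d t" for t
    proof (rule le_value_fun)
      fix t
      show "?V d t \<le> policy_backup P r \<gamma> (\<lambda>s. return_pmf (?d s)) (?V d) t"
        using less V[of t] by (auto simp only: policy_backup_return_pmf fun_upd_apply split: if_splits)
    qed
    have "bellman_backup P r \<gamma> (?V d) s a \<le> bellman_backup P r \<gamma> (?V ?d) s a"
      by (intro bellman_backup_mono le discount)
    also have "\<dots> = ?V ?d s"
      using value_fun_fixpoint[of "\<lambda>s. return_pmf (?d s)" s]
      by (simp only: policy_backup_return_pmf fun_upd_same)
    finally have "?V d s < ?V ?d s" using less by simp
    then have "?F d < ?F ?d"
      by (intro sum_strict_mono_ex1) (auto simp: le simp del: fun_upd_apply)
    with max[of ?d] show False by simp
  qed
  then show ?thesis by (rule that)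
qed

text \<open>
  If no action improves on \<open>d\<close>, its value dominates every policy backup of itself, hence the value of every
  policy. So the suprema that define the optimal values are attained, all of them by the same policy.
\<close>

lemma exists_optimal_deterministic_policy:
  "\<exists>d. value_fun P r \<gamma> (\<lambda>s. return_pmf (d s)) = opt_value P r \<gamma> \<and>
       q_fun P r \<gamma> (\<lambda>s. return_pmf (d s)) = opt_q P r \<gamma> \<and>
       (\<forall>s a. opt_q P r \<gamma> s a \<le> opt_value P r \<gamma> s) \<and>
       (\<forall>\<pi> s. value_fun P r \<gamma> \<pi> s \<le> opt_value P r \<gamma> s)"
proof -
  obtain d where d: "\<And>s a. q_fun P r \<gamma> (\<lambda>s. return_pmf (d s)) s a
      \<le> value_fun P r \<gamma> (\<lambda>s. return_pmf (d s)) s"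
    using exists_unimprovable_deterministic_policy by blast
  let ?\<pi> = "\<lambda>s. return_pmf (d s)"
  have V: "value_fun P r \<gamma> \<pi> s \<le> value_fun P r \<gamma> ?\<pi> s" for \<pi> s
    using d by (intro value_fun_le) (auto simp: policy_backup_def q_fun_eq_backup[OF mdp] intro!: pmf_average_le)
  have Q: "q_fun P r \<gamma> \<pi> s a \<le> q_fun P r \<gamma> ?\<pi> s a" for \<pi> s a
    unfolding q_fun_eq_backup[OF mdp] by (intro bellman_backup_mono V discount)
  have 1: "value_fun P r \<gamma> ?\<pi> = opt_value P r \<gamma>"
    unfolding opt_value_def by (rule ext, rule sym, rule cSup_eq_maximum) (use V in auto)
  have 2: "q_fun P r \<gamma> ?\<pi> = opt_q P r \<gamma>"
    unfolding opt_q_def by (intro ext, rule sym, rule cSup_eq_maximum) (use Q in auto)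
  show ?thesis
    using d V 1 2 by (intro exI[of _ d]) simp
qed

lemma value_fun_le_opt_value: "value_fun P r \<gamma> \<pi> s \<le> opt_value P r \<gamma> s"
  using exists_optimal_deterministic_policy by blast

lemma opt_q_le_opt_value: "opt_q P r \<gamma> s a \<le> opt_value P r \<gamma> s"
  using exists_optimal_deterministic_policy by blast

lemma opt_q_eq_backup: "opt_q P r \<gamma> s a = bellman_backup P r \<gamma> (opt_value P r \<gamma>) s a"
proof -
  obtain d where d: "value_fun P r \<gamma> (\<lambda>s. return_pmf (d s)) = opt_value P r \<gamma>"
    "q_fun P r \<gamma> (\<lambda>s. return_pmf (d s)) = opt_q P r \<gamma>"
    using exists_optimal_deterministic_policy by blast
  show ?thesis
    using q_fun_eq_backup[OF mdp, of "\<lambda>s. return_pmf (d s)" s a] by (simp add: d)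
qed

lemma opt_policies_nonempty: "opt_policies P r \<gamma> \<noteq> {}"
  using exists_optimal_deterministic_policy by (auto simp: opt_policies_def)

lemma opt_actions_nonempty: "opt_actions P r \<gamma> s \<noteq> {}"
proof -
  obtain d where d: "value_fun P r \<gamma> (\<lambda>s. return_pmf (d s)) = opt_value P r \<gamma>"
    using exists_optimal_deterministic_policy by blast
  have "opt_q P r \<gamma> s (d s) = opt_value P r \<gamma> s"
    using value_fun_fixpoint[of "\<lambda>s. return_pmf (d s)" s]
    by (simp add: policy_backup_return_pmf d opt_q_eq_backup)
  then show ?thesis by (auto simp: opt_actions_def)
qed

lemma opt_policies_backup:
  assumes "\<rho> \<in> opt_policies P r \<gamma>"
  shows "policy_backup P r \<gamma> \<rho> (opt_value P r \<gamma>) s = opt_value P r \<gamma> s"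
  using assms value_fun_fixpoint[of \<rho> s] by (simp add: opt_policies_def)

text \<open>
  Under such a policy the optimal value is a fixed point of the policy backup, hence at most the value of
  the policy.
\<close>

lemma supported_on_opt_actions_imp_optimal:
  assumes supp: "\<And>s a. a \<notin> opt_actions P r \<gamma> s \<Longrightarrow> pmf (\<rho> s) a = 0"
  shows "\<rho> \<in> opt_policies P r \<gamma>"
proof -
  have "policy_backup P r \<gamma> \<rho> (opt_value P r \<gamma>) s = (\<Sum>a\<in>UNIV. pmf (\<rho> s) a * opt_value P r \<gamma> s)" for s
    unfolding policy_backup_def
  proof (rule sum.cong[OF refl])
    fix a
    show "pmf (\<rho> s) a * bellman_backup P r \<gamma> (opt_value P r \<gamma>) s a = pmf (\<rho> s) a * opt_value P r \<gamma> s"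
      using supp[of a s] by (cases "a \<in> opt_actions P r \<gamma> s") (auto simp: opt_actions_def opt_q_eq_backup)
  qed
  then have "policy_backup P r \<gamma> \<rho> (opt_value P r \<gamma>) s = opt_value P r \<gamma> s" for s
    by (simp add: sum_distrib_right[symmetric] sum_pmf_UNIV)
  then have "opt_value P r \<gamma> s \<le> value_fun P r \<gamma> \<rho> s" for s
    by (intro le_value_fun) simp
  then have "value_fun P r \<gamma> \<rho> = opt_value P r \<gamma>"
    by (intro ext antisym value_fun_le_opt_value)
  then show ?thesis by (simp add: opt_policies_def)
qed

lemma q_error_bounds:
  shows "q_fun P r \<gamma> \<pi> s a \<le> opt_q P r \<gamma> s a"
    and "opt_q P r \<gamma> s a - q_fun P r \<gamma> \<pi> s a
           \<le> sup_norm (\<lambda>s. opt_value P r \<gamma> s - value_fun P r \<gamma> \<pi> s)"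
proof -
  let ?e = "sup_norm (\<lambda>s. opt_value P r \<gamma> s - value_fun P r \<gamma> \<pi> s)"
  show "q_fun P r \<gamma> \<pi> s a \<le> opt_q P r \<gamma> s a"
    unfolding q_fun_eq_backup[OF mdp] opt_q_eq_backup
    by (intro bellman_backup_mono value_fun_le_opt_value discount)
  have e: "opt_value P r \<gamma> s - value_fun P r \<gamma> \<pi> s \<le> ?e" for s
    using abs_le_sup_norm[of "\<lambda>s. opt_value P r \<gamma> s - value_fun P r \<gamma> \<pi> s" s] by simp
  moreover have "0 \<le> ?e"
    using e[of s] value_fun_le_opt_value[of \<pi> s] by linarith
  ultimately show "opt_q P r \<gamma> s a - q_fun P r \<gamma> \<pi> s a \<le> ?e"
    unfolding q_fun_eq_backup[OF mdp] opt_q_eq_backup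
    using discount by (intro bellman_backup_diff_le) auto
qed

lemma policy_improvement:
  assumes "\<And>s. value_fun P r \<gamma> \<pi> s \<le> policy_backup P r \<gamma> \<pi>' (value_fun P r \<gamma> \<pi>) s"
  shows "policy_backup P r \<gamma> \<pi>' (value_fun P r \<gamma> \<pi>) s \<le> value_fun P r \<gamma> \<pi>' s"
proof -
  have "policy_backup P r \<gamma> \<pi>' (value_fun P r \<gamma> \<pi>) s
      \<le> policy_backup P r \<gamma> \<pi>' (value_fun P r \<gamma> \<pi>') s"
    by (intro policy_backup_mono discount le_value_fun assms)
  then show ?thesis by (simp add: value_fun_fixpoint[symmetric])
qed

text \<open>
  The policy iteration is described abstractly: \<open>D\<close> is a nonnegative potential whose decrease pays for the
  regret of step \<open>k\<close> against an optimal policy \<open>\<rho>\<close>. With \<open>\<delta> k\<close> the value error, the residual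
  \<open>\<delta> k - \<gamma> * policy_transition P \<rho> (\<delta> k)\<close> splits into that regret and the one-step improvement, and the
  improvement is at most \<open>\<delta> k - \<delta> (Suc k)\<close>. Both parts telescope, so the partial sums of \<open>\<delta>\<close> satisfy the
  discounted maximum principle with a bound \<open>c\<close> that does not depend on the number of terms.
\<close>

lemma summable_value_errors:
  fixes \<pi> :: "nat \<Rightarrow> 's \<Rightarrow> 'a pmf" and D :: "nat \<Rightarrow> 's \<Rightarrow> real"
  assumes \<rho>: "\<rho> \<in> opt_policies P r \<gamma>"
    and improve: "\<And>k s. value_fun P r \<gamma> (\<pi> k) s
                     \<le> policy_backup P r \<gamma> (\<pi> (Suc k)) (value_fun P r \<gamma> (\<pi> k)) s"
    and regret: "\<And>k s. policy_backup P r \<gamma> \<rho> (value_fun P r \<gamma> (\<pi> k)) s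
                     - policy_backup P r \<gamma> (\<pi> (Suc k)) (value_fun P r \<gamma> (\<pi> k)) s
                     \<le> D k s - D (Suc k) s"
    and D_nonneg: "\<And>k s. 0 \<le> D k s"
  shows "summable (\<lambda>k. sup_norm (\<lambda>s. opt_value P r \<gamma> s - value_fun P r \<gamma> (\<pi> k) s))"
proof -
  let ?V = "opt_value P r \<gamma>" and ?W = "\<lambda>k. value_fun P r \<gamma> (\<pi> k)"
  define \<delta> where "\<delta> k s = ?V s - ?W k s" for k s
  define c where "c = (\<Sum>s\<in>UNIV. D 0 s + \<delta> 0 s)"
  have \<delta>: "0 \<le> \<delta> k s" for k s
    using value_fun_le_opt_value by (simp add: \<delta>_def)
  have step: "\<delta> k s - \<gamma> * policy_transition P \<rho> (\<delta> k) s
      \<le> (D k s - D (Suc k) s) + (\<delta> k s - \<delta> (Suc k) s)" for k s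
    using regret[of k s] policy_improvement[OF improve, of k s] opt_policies_backup[OF \<rho>, of s]
      policy_backup_diff[of P r \<gamma> \<rho> ?V s "?W k"]
    unfolding \<delta>_def by linarith
  have bound: "(\<Sum>k<n. \<delta> k s) \<le> c / (1 - \<gamma>)" for n s
  proof (rule discounted_maximum_principle[OF discount])
    fix s
    have "(\<Sum>k<n. \<delta> k s) - \<gamma> * policy_transition P \<rho> (\<lambda>s. \<Sum>k<n. \<delta> k s) s
        = (\<Sum>k<n. \<delta> k s - \<gamma> * policy_transition P \<rho> (\<delta> k) s)"
    proof -
      have "policy_transition P \<rho> (\<lambda>s. \<Sum>k<n. \<delta> k s) s = (\<Sum>k<n. policy_transition P \<rho> (\<delta> k) s)"
        by (induction n) (simp_all add: policy_transition_def algebra_simps sum.distrib)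
      then show ?thesis by (simp add: sum_subtractf sum_distrib_left)
    qed
    also have "\<dots> \<le> (\<Sum>k<n. (D k s - D (Suc k) s) + (\<delta> k s - \<delta> (Suc k) s))"
      by (intro sum_mono step)
    also have "\<dots> = (D 0 s - D n s) + (\<delta> 0 s - \<delta> n s)"
      using sum_lessThan_telescope'[of "\<lambda>k. D k s" n] sum_lessThan_telescope'[of "\<lambda>k. \<delta> k s" n]
      by (simp add: sum.distrib)
    also have "\<dots> \<le> D 0 s + \<delta> 0 s"
      using D_nonneg[of n s] \<delta>[of n s] by linarith
    also have "\<dots> \<le> c"
      unfolding c_def by (rule member_le_sum) (use D_nonneg \<delta> in auto)
    finally show "(\<Sum>k<n. \<delta> k s) \<le> c + \<gamma> * policy_transition P \<rho> (\<lambda>s. \<Sum>k<n. \<delta> k s) s"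
      by simp
  qed
  have "summable (\<lambda>k. \<delta> k s)" for s
    using bound \<delta> by (intro summableI_nonneg_bounded)
  then have sum: "summable (\<lambda>k. \<Sum>s\<in>UNIV. \<delta> k s)"
    by (rule summable_sum)
  have "norm (sup_norm (\<delta> k)) \<le> (\<Sum>s\<in>UNIV. \<delta> k s)" for k
  proof -
    have "0 \<le> sup_norm (\<delta> k)"
      using abs_le_sup_norm[of "\<delta> k" undefined] by linarith
    moreover have "\<bar>\<delta> k s\<bar> \<le> (\<Sum>s\<in>UNIV. \<delta> k s)" for s
      using \<delta> by (simp add: member_le_sum)
    ultimately show ?thesis
      by (simp add: sup_norm_def)
  qed
  then have "summable (\<lambda>k. sup_norm (\<delta> k))"
    by (intro summable_comparison_test'[OF sum, where N=0]) auto
  then show ?thesis by (simp add: \<delta>_def[abs_def])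
qed

end

section \<open>Steep mirror maps\<close>

text \<open>
  A mirror map whose derivative blows up at both ends of the unit interval. The real-valued restriction
  \<open>\<phi>\<close> takes a junk value outside the effective domain of \<open>\<psi>\<close>.
\<close>

locale steep_mirror_map =
  fixes \<psi> :: "real \<Rightarrow> ereal"
  assumes mirror: "mirror_map \<psi>"
    and deriv_0: "filterlim (ereal_deriv \<psi>) at_bot (at_right 0)"
    and deriv_1: "filterlim (ereal_deriv \<psi>) at_top (at_left 1)"
begin

abbreviation g :: "real \<Rightarrow> real" where
  "g \<equiv> ereal_deriv \<psi>"

definition \<phi> :: "real \<Rightarrow> real" where
  "\<phi> x = real_of_ereal (\<psi> x)"

lemma ereal_\<phi>: "x \<in> eff_dom \<psi> \<Longrightarrow> \<psi> x = ereal (\<phi> x)"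
  using mirror unfolding mirror_map_def eff_dom_def \<phi>_def
  by (cases "\<psi> x") auto

lemma unit_interval_subset_dom: "{0..1} \<subseteq> eff_dom \<psi>"
  using mirror unfolding mirror_map_def by blast

lemma convex_eff_dom: "convex (eff_dom \<psi>)"
  and convex_on_\<phi>: "convex_on (eff_dom \<psi>) \<phi>"
proof -
  have epi: "convex (ereal_epigraph \<psi>)"
    using mirror unfolding mirror_map_def by blast
  have comb: "\<psi> (u * x + v * y) \<le> ereal (u * \<phi> x + v * \<phi> y)"
    if "x \<in> eff_dom \<psi>" "y \<in> eff_dom \<psi>" "0 \<le> u" "0 \<le> v" "u + v = 1" for x y u v
  proof -
    have "(x, \<phi> x) \<in> ereal_epigraph \<psi>" "(y, \<phi> y) \<in> ereal_epigraph \<psi>"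
      using that by (auto simp: ereal_epigraph_def ereal_\<phi>)
    from convexD[OF epi this that(3-5)] show ?thesis
      by (simp add: ereal_epigraph_def)
  qed
  show dom: "convex (eff_dom \<psi>)"
  proof (rule convexI)
    fix x y and u v :: real
    assume "x \<in> eff_dom \<psi>" "y \<in> eff_dom \<psi>" "0 \<le> u" "0 \<le> v" "u + v = 1"
    from comb[OF this] show "u *\<^sub>R x + v *\<^sub>R y \<in> eff_dom \<psi>"
      by (auto simp: eff_dom_def)
  qed
  show "convex_on (eff_dom \<psi>) \<phi>"
  proof (rule convex_onI[OF _ dom])
    fix t x y :: real
    assume t: "0 < t" "t < 1" "x \<in> eff_dom \<psi>" "y \<in> eff_dom \<psi>"
    then have "(1 - t) * x + t * y \<in> eff_dom \<psi>"
      using convexD[OF dom, of x y "1 - t" t] by simp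
    then show "\<phi> ((1 - t) *\<^sub>R x + t *\<^sub>R y) \<le> (1 - t) * \<phi> x + t * \<phi> y"
      using comb[of x y "1 - t" t] t by (simp add: ereal_\<phi>)
  qed
qed

lemma DERIV_\<phi>:
  assumes "x \<in> interior (eff_dom \<psi>)"
  shows "DERIV \<phi> x :> g x"
proof -
  have "\<phi> differentiable (at x)"
    using mirror assms unfolding mirror_map_def \<phi>_def[abs_def] by blast
  then obtain D where D: "DERIV \<phi> x :> D" by (auto simp: real_differentiable_def)
  then show ?thesis
    using DERIV_imp_deriv[OF D] unfolding ereal_deriv_def \<phi>_def[abs_def] by simp
qed

lemma above_tangent:
  assumes "x \<in> interior (eff_dom \<psi>)" "y \<in> eff_dom \<psi>"
  shows "\<phi> x + g x * (y - x) \<le> \<phi> y"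
  using convex_on_imp_above_tangent[OF convex_on_\<phi> convex_connected[OF convex_eff_dom] assms]
    has_field_derivative_at_within[OF DERIV_\<phi>[OF assms(1)]] by fastforce

text \<open>
  Compare the tangents at \<open>x\<close> and at \<open>y\<close> with the value at the midpoint, where \<open>\<phi>\<close> lies strictly below the
  chord.
\<close>

lemma g_strict_mono_interior:
  assumes x: "x \<in> interior (eff_dom \<psi>)" and y: "y \<in> interior (eff_dom \<psi>)" and "x < y"
  shows "g x < g y"
proof -
  define m where "m = (1 - 1/2) * x + 1/2 * y"
  have xD: "x \<in> eff_dom \<psi>" and yD: "y \<in> eff_dom \<psi>"
    using x y interior_subset by blast+
  have mD: "m \<in> eff_dom \<psi>"
    using convexD[OF convex_eff_dom xD yD, of "1/2" "1/2"] by (simp add: m_def)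
  have "\<psi> m < ereal (1 - 1/2) * \<psi> x + ereal (1/2) * \<psi> y"
  proof -
    have "\<forall>x\<in>interior (eff_dom \<psi>). \<forall>y\<in>interior (eff_dom \<psi>). \<forall>u. x \<noteq> y \<and> 0 < u \<and> u < 1 \<longrightarrow>
        \<psi> ((1 - u) * x + u * y) < ereal (1 - u) * \<psi> x + ereal u * \<psi> y"
      using mirror unfolding mirror_map_def by blast
    from this[rule_format, OF x y, of "1/2"] show ?thesis
      using \<open>x < y\<close> unfolding m_def by simp
  qed
  then have "2 * \<phi> m < \<phi> x + \<phi> y"
    by (simp add: ereal_\<phi> xD yD mD)
  moreover have "\<phi> x + g x * (m - x) \<le> \<phi> m" "\<phi> y + g y * (m - y) \<le> \<phi> m"
    using above_tangent[OF x mD] above_tangent[OF y mD] by simp_all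
  moreover have "m - x = (y - x) / 2" "m - y = - ((y - x) / 2)"
    by (simp_all add: m_def field_simps)
  ultimately have "g x * ((y - x) / 2) < g y * ((y - x) / 2)"
    by simp
  then show ?thesis
    using \<open>x < y\<close> by (simp add: mult_less_cancel_right)
qed

text \<open>
  If \<open>0\<close> were an interior point of the domain, monotonicity would give \<open>g 0 < g x\<close> for small \<open>x > 0\<close>, whereas
  \<open>g\<close> tends to \<open>-\<infinity>\<close> at \<open>0\<close>; the endpoint \<open>1\<close> is symmetric. An interval that contains \<open>(0,1)\<close> but neither
  endpoint is \<open>(0,1)\<close>.
\<close>

lemma interior_dom_eq: "interior (eff_dom \<psi>) = {0<..<1}"
proof
  let ?I = "interior (eff_dom \<psi>)"
  show sub: "{0<..<1} \<subseteq> ?I"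
    using unit_interval_subset_dom by (intro interior_maximal) auto
  have I: "is_interval ?I"
    using convex_interior[OF convex_eff_dom] by (simp add: is_interval_convex_1)
  have half: "1/2 \<in> ?I" using sub by auto
  have 0: "0 \<notin> ?I"
  proof
    assume in0: "0 \<in> ?I"
    have "eventually (\<lambda>x. x \<in> ?I) (nhds 0)"
      using in0 by (rule eventually_nhds_in_open[OF open_interior])
    then have "eventually (\<lambda>x. x \<in> ?I) (at_right 0)"
      by (rule filter_leD[OF at_within_le_nhds])
    moreover have "eventually (\<lambda>x. g x < g 0) (at_right 0)"
      using deriv_0 by (simp add: filterlim_at_bot_dense)
    moreover have "eventually (\<lambda>x. (0::real) < x) (at_right 0)"
      by (simp add: eventually_at_filter)
    ultimately have "eventually (\<lambda>x::real. False) (at_right 0)"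
      by eventually_elim (use g_strict_mono_interior[OF in0] in fastforce)
    then show False by simp
  qed
  have 1: "1 \<notin> ?I"
  proof
    assume in1: "1 \<in> ?I"
    have "eventually (\<lambda>x. x \<in> ?I) (nhds 1)"
      using in1 by (rule eventually_nhds_in_open[OF open_interior])
    then have "eventually (\<lambda>x. x \<in> ?I) (at_left 1)"
      by (rule filter_leD[OF at_within_le_nhds])
    moreover have "eventually (\<lambda>x. g 1 < g x) (at_left 1)"
      using deriv_1 by (simp add: filterlim_at_top_dense)
    moreover have "eventually (\<lambda>x. x < (1::real)) (at_left 1)"
      by (simp add: eventually_at_filter)
    ultimately have "eventually (\<lambda>x::real. False) (at_left 1)"
      by eventually_elim (use g_strict_mono_interior[OF _ in1] in fastforce)
    then show False by simp
  qed
  show "?I \<subseteq> {0<..<1}"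
  proof
    fix x assume x: "x \<in> ?I"
    have "0 < x"
      using mem_is_interval_1_I[OF I x half, of 0] 0 by force
    moreover have "x < 1"
      using mem_is_interval_1_I[OF I half x, of 1] 1 by force
    ultimately show "x \<in> {0<..<1}" by simp
  qed
qed

lemma tangent_le:
  assumes "x \<in> {0<..<1}" "y \<in> {0..1}"
  shows "\<phi> x + g x * (y - x) \<le> \<phi> y"
  using above_tangent[of x y] assms unit_interval_subset_dom interior_dom_eq by blast

lemma g_strict_mono: "x \<in> {0<..<1} \<Longrightarrow> y \<in> {0<..<1} \<Longrightarrow> x < y \<Longrightarrow> g x < g y"
  using g_strict_mono_interior[of x y] by (simp add: interior_dom_eq)

lemma g_mono: "x \<in> {0<..<1} \<Longrightarrow> y \<in> {0<..<1} \<Longrightarrow> x \<le> y \<Longrightarrow> g x \<le> g y"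
  using g_strict_mono[of x y] by (cases "x = y") auto

lemma g_less_iff: "x \<in> {0<..<1} \<Longrightarrow> y \<in> {0<..<1} \<Longrightarrow> g x < g y \<longleftrightarrow> x < y"
  using g_strict_mono[of x y] g_mono[of y x] by (auto simp: not_less[symmetric])

text \<open>
  A convex differentiable function is continuously differentiable. The derivative at \<open>z\<close> is bounded above by
  the slope of the chord from \<open>z\<close> to any fixed \<open>y > x\<close>, and this slope is continuous in \<open>z\<close>; taking \<open>y\<close>
  close to \<open>x\<close> makes it nearly \<open>g x\<close>. Points \<open>y < x\<close> give the lower bound.
\<close>

lemma isCont_g:
  assumes x: "x \<in> {0<..<1}"
  shows "isCont g x"
proof -
  have der: "DERIV \<phi> x :> g x"
    using DERIV_\<phi> x by (simp add: interior_dom_eq)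
  have cont: "isCont \<phi> x" using der by (rule DERIV_isCont)
  have near: "eventually (\<lambda>z. z \<in> {0<..<1}) (nhds x)"
    using x by (intro eventually_nhds_in_open) auto
  have quot: "((\<lambda>z. (\<phi> z - \<phi> x) / (z - x)) \<longlongrightarrow> g x) (at x)"
    using der by (simp add: has_field_derivative_iff)
  show ?thesis
    unfolding isCont_def
  proof (rule order_tendstoI)
    fix u assume u: "g x < u"
    have "eventually (\<lambda>y. (\<phi> y - \<phi> x) / (y - x) < u) (at_right x)"
      using order_tendstoD(2)[OF quot u] by (rule filter_leD[OF at_le, rotated]) auto
    moreover have "eventually (\<lambda>y. y \<in> {x<..<1}) (at_right x)"
      using x by (intro eventually_at_right_real) auto
    ultimately have "eventually (\<lambda>y. (\<phi> y - \<phi> x) / (y - x) < u \<and> y \<in> {x<..<1}) (at_right x)"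
      by eventually_elim simp
    then obtain y where y: "(\<phi> y - \<phi> x) / (y - x) < u" "y \<in> {x<..<1}"
      using eventually_happens'[OF trivial_limit_at_right_real] by blast
    have "((\<lambda>z. (\<phi> y - \<phi> z) / (y - z)) \<longlongrightarrow> (\<phi> y - \<phi> x) / (y - x)) (at x)"
      using cont y by (intro tendsto_intros) (auto simp: isCont_def)
    then have "eventually (\<lambda>z. (\<phi> y - \<phi> z) / (y - z) < u) (at x)"
      using y(1) by (rule order_tendstoD)
    moreover have "eventually (\<lambda>z. z \<in> {0<..<1}) (at x)"
      using near by (rule filter_leD[OF at_within_le_nhds])
    moreover have "eventually (\<lambda>z. z < y) (at x)"
      using y by (intro order_tendstoD(2)[OF tendsto_ident_at]) auto
    ultimately show "eventually (\<lambda>z. g z < u) (at x)"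
    proof eventually_elim
      case (elim z)
      have "g z \<le> (\<phi> y - \<phi> z) / (y - z)"
        using tangent_le[of z y] elim y by (simp add: field_simps)
      with elim show ?case by simp
    qed
  next
    fix u assume u: "u < g x"
    have "eventually (\<lambda>y. u < (\<phi> y - \<phi> x) / (y - x)) (at_left x)"
      using order_tendstoD(1)[OF quot u] by (rule filter_leD[OF at_le, rotated]) auto
    moreover have "eventually (\<lambda>y. y \<in> {0<..<x}) (at_left x)"
      using x by (intro eventually_at_left_real) auto
    ultimately have "eventually (\<lambda>y. u < (\<phi> y - \<phi> x) / (y - x) \<and> y \<in> {0<..<x}) (at_left x)"
      by eventually_elim simp
    then obtain y where y: "u < (\<phi> y - \<phi> x) / (y - x)" "y \<in> {0<..<x}"
      using eventually_happens'[OF trivial_limit_at_left_real] by blast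
    have "((\<lambda>z. (\<phi> y - \<phi> z) / (y - z)) \<longlongrightarrow> (\<phi> y - \<phi> x) / (y - x)) (at x)"
      using cont y by (intro tendsto_intros) (auto simp: isCont_def)
    then have "eventually (\<lambda>z. u < (\<phi> y - \<phi> z) / (y - z)) (at x)"
      using y(1) by (rule order_tendstoD)
    moreover have "eventually (\<lambda>z. z \<in> {0<..<1}) (at x)"
      using near by (rule filter_leD[OF at_within_le_nhds])
    moreover have "eventually (\<lambda>z. y < z) (at x)"
      using y by (intro order_tendstoD(1)[OF tendsto_ident_at]) auto
    ultimately show "eventually (\<lambda>z. u < g z) (at x)"
    proof eventually_elim
      case (elim z)
      have "(\<phi> y - \<phi> z) / (y - z) \<le> g z"
        using tangent_le[of z y] elim y x by (simp add: field_simps)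
      with elim show ?case by simp
    qed
  qed
qed

lemma gradient_separable:
  fixes q :: "real ^ 'a::finite"
  assumes q: "\<And>a. q $ a \<in> {0<..<1}"
  shows "gradient (\<lambda>x. real_of_ereal (separable \<psi> x)) q = (\<chi> a. g (q $ a))"
proof -
  let ?f = "\<lambda>x :: real ^ 'a. real_of_ereal (separable \<psi> x)"
  let ?U = "{x :: real ^ 'a. \<forall>a. x $ a \<in> {0<..<1}}"
  have "?U = (\<Inter>a\<in>UNIV. (\<lambda>x. x $ a) -` {0<..<1})" by auto
  then have U: "open ?U"
    by (auto intro!: open_INT open_vimage continuous_intros)
  have eq: "?f x = (\<Sum>a\<in>UNIV. \<phi> (x $ a))" if "x \<in> ?U" for x
  proof -
    have "separable \<psi> x = (\<Sum>a\<in>UNIV. ereal (\<phi> (x $ a)))"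
      unfolding separable_def
    proof (intro sum.cong refl ereal_\<phi>)
      fix a show "x $ a \<in> eff_dom \<psi>"
        using that unit_interval_subset_dom by (auto simp: less_imp_le subset_iff)
    qed
    then show ?thesis by simp
  qed
  have "((\<lambda>x. \<Sum>a\<in>UNIV. \<phi> (x $ a)) has_derivative (\<lambda>h. \<Sum>a\<in>UNIV. g (q $ a) * h $ a)) (at q)"
  proof (rule has_derivative_sum)
    fix a
    have "(\<phi> has_derivative (*) (g (q $ a))) (at (q $ a))"
      using DERIV_\<phi>[of "q $ a"] q by (simp add: interior_dom_eq has_field_derivative_def)
    then show "((\<lambda>x. \<phi> (x $ a)) has_derivative (\<lambda>h. g (q $ a) * h $ a)) (at q)"
      by (rule has_derivative_compose[rotated, of _ _ "\<lambda>x. x $ a"])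
         (rule bounded_linear_imp_has_derivative[OF bounded_linear_vec_nth])
  qed
  then have "(?f has_derivative (\<lambda>h. \<Sum>a\<in>UNIV. g (q $ a) * h $ a)) (at q)"
    by (rule has_derivative_transform_within_open[OF _ U]) (use q eq in auto)
  then have grad: "GDERIV ?f q :> (\<chi> a. g (q $ a))"
    by (simp add: gderiv_def inner_vec_def mult.commute)
  show ?thesis
    unfolding gradient_def
  proof (rule the_equality[where P="\<lambda>D. GDERIV ?f q :> D", OF grad])
    fix D assume "GDERIV ?f q :> D"
    then have "(\<lambda>h. h \<bullet> D) = (\<lambda>h. h \<bullet> (\<chi> a. g (q $ a)))"
      using grad unfolding gderiv_def by (rule has_derivative_unique)
    then have "\<forall>h. h \<bullet> D = h \<bullet> (\<chi> a. g (q $ a))"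
      by (simp add: fun_eq_iff)
    then show "D = (\<chi> a. g (q $ a))"
      by (simp only: vector_eq_ldot)
  qed
qed

definition divergence :: "('a::finite \<Rightarrow> real) \<Rightarrow> ('a \<Rightarrow> real) \<Rightarrow> real" where
  "divergence p q = (\<Sum>a\<in>UNIV. \<phi> (p a) - \<phi> (q a) - g (q a) * (p a - q a))"

lemma divergence_nonneg:
  assumes "\<And>a. p a \<in> {0..1}" "\<And>a. q a \<in> {0<..<1}"
  shows "0 \<le> divergence p q"
  unfolding divergence_def
proof (rule sum_nonneg)
  fix a
  show "0 \<le> \<phi> (p a) - \<phi> (q a) - g (q a) * (p a - q a)"
    using tangent_le[OF assms(2) assms(1), of a a] by linarith
qed

text \<open>
  On the simplex and with an interior base point all extended-real terms are finite.
\<close>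

lemma bregman_separable:
  fixes p q :: "'a::finite pmf"
  assumes q: "\<And>a. pmf q a \<in> {0<..<1}"
  shows "bregman (separable \<psi>) (prob_vec p) (prob_vec q) = ereal (divergence (pmf p) (pmf q))"
proof -
  have fin: "separable \<psi> (prob_vec p') = ereal (\<Sum>a\<in>UNIV. \<phi> (pmf p' a))" for p' :: "'a pmf"
  proof -
    have "separable \<psi> (prob_vec p') = (\<Sum>a\<in>UNIV. ereal (\<phi> (pmf p' a)))"
      unfolding separable_def prob_vec_def vec_lambda_beta
      using unit_interval_subset_dom by (intro sum.cong refl ereal_\<phi>) (auto simp: pmf_le_1 subset_iff)
    then show ?thesis by simp
  qed
  have "gradient (\<lambda>x. real_of_ereal (separable \<psi> x)) (prob_vec q) = (\<chi> a. g (prob_vec q $ a))"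
    by (rule gradient_separable) (use q in \<open>simp add: prob_vec_def\<close>)
  then show ?thesis
    unfolding bregman_def fin
    by (simp add: divergence_def inner_vec_def prob_vec_def sum_subtractf)
qed

lemma three_point_identity:
  "(\<Sum>a\<in>UNIV. (g (q' a) - g (q a)) * (p a - q' a)) = divergence p q - divergence p q' - divergence q' q"
  unfolding divergence_def sum_subtractf[symmetric]
  by (intro sum.cong refl) (simp add: algebra_simps)

end

section \<open>The mirror step and convergence of policies\<close>

lemma obtain_pmf_of_finite_type:
  fixes f :: "'b::finite \<Rightarrow> real"
  assumes "\<And>x. 0 \<le> f x" "(\<Sum>x\<in>UNIV. f x) = 1"
  obtains p where "\<And>x. pmf p x = f x"
proof
  have "(\<integral>\<^sup>+x. ennreal (f x) \<partial>count_space UNIV) = 1"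
    using assms by (simp add: nn_integral_count_space_finite)
  then show "pmf (embed_pmf f) x = f x" for x
    using assms(1) by (intro pmf_embed_pmf)
qed

lemma pmf_of_unique_support:
  fixes p :: "'b::finite pmf"
  assumes "\<And>b. b \<noteq> a \<Longrightarrow> pmf p b = 0"
  shows "pmf p a = 1"
proof -
  have "(\<Sum>b\<in>UNIV. pmf p b) = (\<Sum>b\<in>{a}. pmf p b)"
    using assms by (intro sum.mono_neutral_right) auto
  then show ?thesis by (simp add: sum_pmf_UNIV)
qed

lemma pmf_add_le_1:
  fixes p :: "'b::finite pmf"
  assumes "a \<noteq> b"
  shows "pmf p a + pmf p b \<le> 1"
proof -
  have "(\<Sum>x\<in>{a, b}. pmf p x) \<le> (\<Sum>x\<in>UNIV. pmf p x)"
    by (intro sum_mono2) auto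
  then show ?thesis using assms by (simp add: sum_pmf_UNIV)
qed

lemma obtain_positive_atom:
  fixes p :: "'b::finite pmf"
  obtains b where "0 < pmf p b"
  using set_pmf_not_empty[of p] by (metis ex_in_conv pmf_positive)

context steep_mirror_map
begin

text \<open>
  Both the interiority of the maximiser and its optimality condition come from one perturbation: move mass
  \<open>t\<close> from \<open>b\<close> to \<open>a\<close>. The tangents are taken at the perturbed points: these are interior even if \<open>pmf p a\<close>
  is \<open>0\<close> or \<open>pmf p b\<close> is \<open>1\<close>, where the tangent is vertical.
\<close>

lemma maximizer_marginal_bound:
  fixes p :: "'a::finite pmf"
  assumes max: "\<And>p' :: 'a pmf. (\<Sum>a\<in>UNIV. c a * pmf p' a - \<phi> (pmf p' a))
                     \<le> (\<Sum>a\<in>UNIV. c a * pmf p a - \<phi> (pmf p a))"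
    and "a \<noteq> b" "0 < t" "t < pmf p b"
  shows "pmf p a + t \<in> {0<..<1}" "pmf p b - t \<in> {0<..<1}"
    and "c a - c b \<le> g (pmf p a + t) - g (pmf p b - t)"
proof -
  show at: "pmf p a + t \<in> {0<..<1}" and bt: "pmf p b - t \<in> {0<..<1}"
    using assms(3,4) pmf_add_le_1[OF \<open>a \<noteq> b\<close>, of p] pmf_nonneg[of p a] pmf_le_1[of p b]
    unfolding greaterThanLessThan_iff by (rule_tac conjI; linarith)+
  define f where "f = (pmf p)(a := pmf p a + t, b := pmf p b - t)"
  have split: "(\<Sum>x\<in>UNIV. h x (u x)) = h a (u a) + h b (u b) + (\<Sum>x\<in>UNIV - {a, b}. h x (u x))"
    for h :: "'a \<Rightarrow> real \<Rightarrow> real" and u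
  proof -
    have "(\<Sum>x\<in>UNIV. h x (u x)) = (\<Sum>x\<in>UNIV - {a, b}. h x (u x)) + (\<Sum>x\<in>{a, b}. h x (u x))"
      by (rule sum.subset_diff) auto
    then show ?thesis using \<open>a \<noteq> b\<close> by simp
  qed
  have rest: "(\<Sum>x\<in>UNIV - {a, b}. h x (f x)) = (\<Sum>x\<in>UNIV - {a, b}. h x (pmf p x))"
    for h :: "'a \<Rightarrow> real \<Rightarrow> real"
    by (intro sum.cong) (auto simp: f_def)
  have fab: "f a = pmf p a + t" "f b = pmf p b - t"
    using \<open>a \<noteq> b\<close> by (simp_all add: f_def)
  have "(\<Sum>x\<in>UNIV. f x) = (\<Sum>x\<in>UNIV. pmf p x)"
    unfolding split[of "\<lambda>_ y. y"] rest[of "\<lambda>_ y. y"] fab by simp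
  moreover have "0 \<le> f x" for x
    using at bt by (auto simp: f_def)
  ultimately obtain p' where p': "\<And>x. pmf p' x = f x"
    by (metis obtain_pmf_of_finite_type sum_pmf_UNIV)
  have "t * (c a - c b) \<le> (\<phi> (pmf p a + t) - \<phi> (pmf p a)) + (\<phi> (pmf p b - t) - \<phi> (pmf p b))"
    using max[of p'] fab
    unfolding p' split[of "\<lambda>x y. c x * y - \<phi> y"] rest[of "\<lambda>x y. c x * y - \<phi> y"]
    by (simp add: algebra_simps)
  also have "\<dots> \<le> t * g (pmf p a + t) + - (t * g (pmf p b - t))"
    using tangent_le[OF at, of "pmf p a"] tangent_le[OF bt, of "pmf p b"]
    by (intro add_mono) (simp_all add: pmf_le_1 mult.commute)
  also have "\<dots> = t * (g (pmf p a + t) - g (pmf p b - t))"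
    by (simp add: algebra_simps)
  finally show "c a - c b \<le> g (pmf p a + t) - g (pmf p b - t)"
    using \<open>0 < t\<close> by simp
qed

text \<open>
  If \<open>pmf p a = 0\<close>, the perturbation bound says that \<open>g t\<close> stays bounded below as \<open>t\<close> tends to \<open>0\<close>.
\<close>

lemma maximizer_positive:
  fixes p :: "'a::finite pmf"
  assumes max: "\<And>p' :: 'a pmf. (\<Sum>a\<in>UNIV. c a * pmf p' a - \<phi> (pmf p' a))
                     \<le> (\<Sum>a\<in>UNIV. c a * pmf p a - \<phi> (pmf p a))"
  shows "0 < pmf p a"
proof (rule ccontr)
  assume "\<not> 0 < pmf p a"
  then have a: "pmf p a = 0" using pmf_nonneg[of p a] by simp
  obtain b where b: "0 < pmf p b" by (rule obtain_positive_atom)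
  with a have ab: "a \<noteq> b" by auto
  have lower: "c a - c b + g (pmf p b / 2) \<le> g t" if t: "t \<in> {0<..<pmf p b / 2}" for t
  proof -
    have "0 < t" "t < pmf p b" using t b by auto
    note * = maximizer_marginal_bound[OF max ab this]
    have "g (pmf p b / 2) \<le> g (pmf p b - t)"
      using *(2) b t pmf_le_1[of p b] by (intro g_mono) auto
    then show ?thesis using *(3) a by simp
  qed
  have "eventually (\<lambda>t. g t < c a - c b + g (pmf p b / 2)) (at_right 0)"
    using deriv_0 by (simp add: filterlim_at_bot_dense)
  moreover have "eventually (\<lambda>t. t \<in> {0<..<pmf p b / 2}) (at_right 0)"
    using b by (intro eventually_at_right_real) auto
  ultimately have "eventually (\<lambda>t::real. False) (at_right 0)"
    by eventually_elim (use lower in force)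
  then show False by simp
qed

text \<open>
  Let \<open>t\<close> tend to \<open>0\<close> in the perturbation bound, for \<open>(a, b)\<close> and for \<open>(b, a)\<close>. The common value is the
  Lagrange multiplier of the constraint that the probabilities add up to 1.
\<close>

lemma maximizer_marginals_equal:
  fixes p :: "'a::finite pmf"
  assumes max: "\<And>p' :: 'a pmf. (\<Sum>a\<in>UNIV. c a * pmf p' a - \<phi> (pmf p' a))
                     \<le> (\<Sum>a\<in>UNIV. c a * pmf p a - \<phi> (pmf p a))"
  shows "c a - g (pmf p a) = c b - g (pmf p b)"
proof -
  have le: "c a - c b \<le> g (pmf p a) - g (pmf p b)" if "a \<noteq> b" for a b
  proof (rule tendsto_lowerbound)
    have pos: "0 < pmf p a" "0 < pmf p b"
      using maximizer_positive[OF max] by auto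
    then have "isCont g (pmf p a)" "isCont g (pmf p b)"
      using pmf_add_le_1[OF that, of p] by (auto intro!: isCont_g)
    then show "((\<lambda>t. g (pmf p a + t) - g (pmf p b - t)) \<longlongrightarrow> g (pmf p a) - g (pmf p b)) (at_right 0)"
      by (intro tendsto_diff isCont_tendsto_compose[where g=g])
         (auto intro!: tendsto_eq_intros)
    have "eventually (\<lambda>t. t \<in> {0<..<pmf p b}) (at_right 0)"
      using pos by (intro eventually_at_right_real) auto
    then show "eventually (\<lambda>t. c a - c b \<le> g (pmf p a + t) - g (pmf p b - t)) (at_right 0)"
      by eventually_elim (use maximizer_marginal_bound(3)[OF max that] in auto)
  qed simp
  show ?thesis
    using le[of a b] le[of b a] by (cases "a = b") auto
qed

text \<open>
  Up to a constant, the objective of the mirror step is a linear function minus \<open>\<phi>\<close> summed over the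
  actions, as in the lemmas on maximizers, with linear coefficients \<open>\<eta> * Q a + g (pmf q a)\<close>.
\<close>

lemma mirror_step_optimality:
  fixes q p :: "'a::finite pmf" and Q :: "'a \<Rightarrow> real"
  assumes q: "\<And>a. pmf q a \<in> {0<..<1}"
    and argmax: "is_arg_max
        (\<lambda>p. ereal (\<eta> * (prob_vec p \<bullet> (\<chi> a. Q a)))
               - bregman (separable \<psi>) (prob_vec p) (prob_vec q)) (\<lambda>_. True) p"
  shows "pmf p a \<in> {0<..<1}"
    and "\<eta> * Q a + g (pmf q a) - g (pmf p a) = \<eta> * Q b + g (pmf q b) - g (pmf p b)"
proof -
  let ?c = "\<lambda>a. \<eta> * Q a + g (pmf q a)"
  let ?F = "\<lambda>p :: 'a pmf. \<Sum>a\<in>UNIV. ?c a * pmf p a - \<phi> (pmf p a)"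
  let ?K = "\<Sum>a\<in>UNIV. \<phi> (pmf q a) - g (pmf q a) * pmf q a"
  have obj: "ereal (\<eta> * (prob_vec p \<bullet> (\<chi> a. Q a)))
      - bregman (separable \<psi>) (prob_vec p) (prob_vec q) = ereal (?F p + ?K)" for p
    unfolding bregman_separable[OF q]
    unfolding divergence_def inner_vec_def prob_vec_def
      sum.distrib[symmetric] sum_distrib_left ereal_minus sum_subtractf[symmetric]
    by (intro arg_cong[where f=ereal] sum.cong refl) (simp add: algebra_simps)
  have max: "?F p' \<le> ?F p" for p'
    using argmax unfolding is_arg_max_linorder obj by simp
  show "?c a - g (pmf p a) = ?c b - g (pmf p b)"
    by (rule maximizer_marginals_equal[OF max])
  obtain b where "b \<noteq> a"
    using pmf_of_unique_support[of a q] q[of a] by fastforce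
  then show "pmf p a \<in> {0<..<1}"
    using pmf_add_le_1[of b a p] maximizer_positive[OF max, of a] maximizer_positive[OF max, of b]
    by auto
qed

text \<open>
  By the optimality condition \<open>\<eta> * Q\<close> differs from \<open>g \<circ> pmf p - g \<circ> pmf q\<close> by a constant, which does not count
  against differences of probability vectors. What remains is the three-point identity.
\<close>

lemma mirror_step_gain:
  fixes q p p' :: "'a::finite pmf"
  assumes opt: "\<And>a b. \<eta> * Q a + g (pmf q a) - g (pmf p a) = \<eta> * Q b + g (pmf q b) - g (pmf p b)"
  shows "\<eta> * ((\<Sum>a\<in>UNIV. pmf p' a * Q a) - (\<Sum>a\<in>UNIV. pmf p a * Q a))
    = divergence (pmf p') (pmf q) - divergence (pmf p') (pmf p) - divergence (pmf p) (pmf q)"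
proof -
  define l where "l = \<eta> * Q undefined + g (pmf q undefined) - g (pmf p undefined)"
  have "\<eta> * Q a = (g (pmf p a) - g (pmf q a)) + l" for a
    using opt[of a undefined] by (simp add: l_def)
  then have "\<eta> * ((\<Sum>a\<in>UNIV. pmf p' a * Q a) - (\<Sum>a\<in>UNIV. pmf p a * Q a))
      = (\<Sum>a\<in>UNIV. (g (pmf p a) - g (pmf q a)) * (pmf p' a - pmf p a) + l * (pmf p' a - pmf p a))"
    unfolding sum_subtractf[symmetric] sum_distrib_left
    by (intro sum.cong refl) (metis (no_types, opaque_lifting) distrib_right left_diff_distrib mult.commute mult.left_commute)
  also have "\<dots> = (\<Sum>a\<in>UNIV. (g (pmf p a) - g (pmf q a)) * (pmf p' a - pmf p a))"
    by (simp add: sum.distrib sum_distrib_left[symmetric] sum_subtractf sum_pmf_UNIV)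
  finally show ?thesis unfolding three_point_identity .
qed

end

lemma convergent_if_unique_subsequential_limit:
  fixes X :: "nat \<Rightarrow> 'b::{heine_borel,real_normed_vector}"
  assumes bdd: "bounded (range X)"
    and uniq: "\<And>\<sigma> \<tau> x y. strict_mono \<sigma> \<Longrightarrow> strict_mono \<tau> \<Longrightarrow> (X \<circ> \<sigma>) \<longlonglongrightarrow> x \<Longrightarrow> (X \<circ> \<tau>) \<longlonglongrightarrow> y \<Longrightarrow> x = y"
  shows "convergent X"
proof -
  obtain l \<sigma> where \<sigma>: "strict_mono \<sigma>" "(X \<circ> \<sigma>) \<longlonglongrightarrow> l"
    using bounded_imp_convergent_subsequence[OF bdd] by blast
  have "X \<longlonglongrightarrow> l"
  proof (rule ccontr)
    assume "\<not> X \<longlonglongrightarrow> l"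
    then obtain e where e: "0 < e" and "\<not> eventually (\<lambda>n. dist (X n) l < e) sequentially"
      unfolding tendsto_iff by blast
    then have "infinite {n. \<not> dist (X n) l < e}"
      by (simp add: eventually_sequentially infinite_nat_iff_unbounded_le)
    then obtain \<tau> :: "nat \<Rightarrow> nat" where \<tau>: "strict_mono \<tau>" "\<And>n. \<tau> n \<in> {n. \<not> dist (X n) l < e}"
      using infinite_enumerate by blast
    have "bounded (range (X \<circ> \<tau>))"
      using bdd by (rule bounded_subset) auto
    then obtain l' \<tau>' where \<tau>': "strict_mono \<tau>'" "((X \<circ> \<tau>) \<circ> \<tau>') \<longlonglongrightarrow> l'"
      using bounded_imp_convergent_subsequence by blast
    have "l' = l"
      using uniq[OF strict_mono_o[OF \<tau>(1) \<tau>'(1)] \<sigma>(1) _ \<sigma>(2)] \<tau>'(2) by (simp add: o_assoc)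
    then have "eventually (\<lambda>n. dist (X (\<tau> (\<tau>' n))) l < e) sequentially"
      using tendstoD[OF \<tau>'(2) e] by simp
    then show False
      using \<tau>(2) by (auto simp: eventually_sequentially)
  qed
  then show ?thesis by (rule convergentI)
qed

context steep_mirror_map
begin

text \<open>
  If \<open>a\<close> has probability at least \<open>e\<close>, then \<open>b\<close> has at most \<open>1 - e\<close>, and the gap is at least \<open>g e - g (1 - e)\<close>.
\<close>

lemma suboptimal_probability_vanishes:
  fixes p :: "nat \<Rightarrow> 'a::finite pmf"
  assumes p: "\<And>k a. pmf (p k) a \<in> {0<..<1}" and "a \<noteq> b"
    and gap: "filterlim (\<lambda>k. g (pmf (p k) a) - g (pmf (p k) b)) at_bot sequentially"
  shows "(\<lambda>k. pmf (p k) a) \<longlonglongrightarrow> 0"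
proof (rule order_tendstoI)
  fix u :: real assume "u < 0"
  then show "eventually (\<lambda>k. u < pmf (p k) a) sequentially"
    by (auto intro!: always_eventually less_le_trans[OF _ pmf_nonneg])
next
  fix u :: real assume "0 < u"
  define e where "e = min u (1/2)"
  have e: "0 < e" "e < 1" "e \<le> u" using \<open>0 < u\<close> by (auto simp: e_def)
  have "eventually (\<lambda>k. g (pmf (p k) a) - g (pmf (p k) b) < g e - g (1 - e)) sequentially"
    using gap by (simp add: filterlim_at_bot_dense)
  then show "eventually (\<lambda>k. pmf (p k) a < u) sequentially"
  proof eventually_elim
    case (elim k)
    show ?case
    proof (rule ccontr)
      assume "\<not> ?thesis"
      then have "e \<le> pmf (p k) a" using e by simp
      moreover have "pmf (p k) b \<le> 1 - e"
        using pmf_add_le_1[OF \<open>a \<noteq> b\<close>, of "p k"] calculation by linarith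
      ultimately have "g e \<le> g (pmf (p k) a)" "g (pmf (p k) b) \<le> g (1 - e)"
        using e p by (auto intro!: g_mono)
      then show False using elim by linarith
    qed
  qed
qed

text \<open>
  By compactness it suffices that all subsequential limits agree. A limit is supported on \<open>B\<close> and charges
  all of \<open>B\<close>: if \<open>g\<close> tended to \<open>-\<infinity>\<close> at one action of \<open>B\<close>, the convergent gaps would force the same at every
  other one, and no mass would remain. So if \<open>B\<close> has at least two actions, their limit probabilities lie in
  \<open>(0,1)\<close>, where \<open>g\<close> is continuous, and two limits \<open>x\<close>, \<open>y\<close> have the same gaps. If \<open>x\<close>
  exceeded \<open>y\<close> at one action of \<open>B\<close>, it would do so at all of them, although both sum to 1.
\<close>

lemma policy_sequence_converges:
  fixes p :: "nat \<Rightarrow> 'a::finite pmf" and B :: "'a set"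
  assumes p: "\<And>k a. pmf (p k) a \<in> {0<..<1}"
    and B: "B \<noteq> {}"
    and gap: "\<And>a b. a \<notin> B \<Longrightarrow> b \<in> B \<Longrightarrow>
       filterlim (\<lambda>k. g (pmf (p k) a) - g (pmf (p k) b)) at_bot sequentially"
    and conv: "\<And>a b. a \<in> B \<Longrightarrow> b \<in> B \<Longrightarrow> convergent (\<lambda>k. g (pmf (p k) a) - g (pmf (p k) b))"
  obtains q where "(\<lambda>k. prob_vec (p k)) \<longlonglongrightarrow> prob_vec q"
    and "\<And>a. a \<notin> B \<Longrightarrow> pmf q a = 0" and "\<And>a. a \<in> B \<Longrightarrow> 0 < pmf q a"
proof -
  let ?X = "\<lambda>k. prob_vec (p k)"
  have vanish: "(\<lambda>k. pmf (p k) a) \<longlonglongrightarrow> 0" if "a \<notin> B" for a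
  proof -
    obtain b where "b \<in> B" using B by blast
    then show ?thesis
      using that by (intro suboptimal_probability_vanishes[OF p _ gap]) auto
  qed
  have limit_point: "(\<forall>a. 0 \<le> x $ a) \<and> (\<Sum>a\<in>UNIV. x $ a) = 1 \<and> (\<forall>a. a \<notin> B \<longrightarrow> x $ a = 0) \<and>
      (\<forall>a\<in>B. 0 < x $ a) \<and> (\<forall>a. (\<lambda>k. pmf (p (\<sigma> k)) a) \<longlonglongrightarrow> x $ a)"
    if \<sigma>: "strict_mono \<sigma>" and lim: "(?X \<circ> \<sigma>) \<longlonglongrightarrow> x" for \<sigma> x
  proof -
    have comp: "(\<lambda>k. pmf (p (\<sigma> k)) a) \<longlonglongrightarrow> x $ a" for a
      using tendsto_vec_nth[OF lim, of a] by (simp add: prob_vec_def comp_def)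
    have nonneg: "0 \<le> x $ a" for a
      by (rule LIMSEQ_le_const[OF comp]) auto
    have "(\<lambda>k. \<Sum>a\<in>UNIV. pmf (p (\<sigma> k)) a) \<longlonglongrightarrow> (\<Sum>a\<in>UNIV. x $ a)"
      by (intro tendsto_sum comp)
    then have sum: "(\<Sum>a\<in>UNIV. x $ a) = 1"
      by (simp add: sum_pmf_UNIV LIMSEQ_const_iff)
    have zero: "x $ a = 0" if "a \<notin> B" for a
      using LIMSEQ_unique[OF comp LIMSEQ_subseq_LIMSEQ[OF vanish[OF that] \<sigma>, unfolded comp_def]] .
    \<comment> \<open>An action that keeps positive mass exists; its gap to a vanishing action of B would diverge.\<close>
    have pos: "0 < x $ a" if a: "a \<in> B" for a
    proof (rule ccontr)
      assume "\<not> 0 < x $ a"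
      then have xa: "x $ a = 0" using nonneg[of a] by simp
      obtain b where xb: "0 < x $ b"
      proof -
        have "\<exists>b. x $ b \<noteq> 0"
          using sum by (metis sum.neutral zero_neq_one)
        then show ?thesis using that nonneg by (metis less_eq_real_def)
      qed
      then have b: "b \<in> B" using zero by force
      obtain c where "(\<lambda>k. g (pmf (p k) b) - g (pmf (p k) a)) \<longlonglongrightarrow> c"
        using conv[OF b a] by (auto simp: convergent_def)
      from LIMSEQ_subseq_LIMSEQ[OF this \<sigma>]
      have c: "(\<lambda>k. g (pmf (p (\<sigma> k)) b) - g (pmf (p (\<sigma> k)) a)) \<longlonglongrightarrow> c" by (simp add: comp_def)
      have xb1: "x $ b / 2 \<in> {0<..<1}"
      proof -
        have "x $ b \<le> (\<Sum>a\<in>UNIV. x $ a)" using nonneg by (intro member_le_sum) auto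
        then show ?thesis using xb sum by auto
      qed
      have "filterlim (\<lambda>k. pmf (p (\<sigma> k)) a) (at_right 0) sequentially"
        using comp[of a] p[of "\<sigma> k" a for k] xa
        by (auto simp: filterlim_at less_imp_neq[THEN not_sym] intro!: always_eventually)
      then have "filterlim (\<lambda>k. g (pmf (p (\<sigma> k)) a)) at_bot sequentially"
        by (rule filterlim_compose[OF deriv_0])
      then have "eventually (\<lambda>k. g (pmf (p (\<sigma> k)) a) < g (x $ b / 2) - (c + 1)) sequentially"
        by (simp add: filterlim_at_bot_dense)
      moreover have "eventually (\<lambda>k. g (pmf (p (\<sigma> k)) b) - g (pmf (p (\<sigma> k)) a) < c + 1) sequentially"
        using order_tendstoD(2)[OF c, of "c + 1"] by simp
      moreover have "eventually (\<lambda>k. x $ b / 2 < pmf (p (\<sigma> k)) b) sequentially"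
        using order_tendstoD(1)[OF comp[of b], of "x $ b / 2"] xb by simp
      ultimately have "eventually (\<lambda>k::nat. False) sequentially"
      proof eventually_elim
        case (elim k)
        then show False using g_strict_mono[OF xb1 p, of "\<sigma> k" b] by linarith
      qed
      then show False by simp
    qed
    show ?thesis using nonneg sum zero pos comp by blast
  qed
  have le: "x $ a \<le> y $ a"
    if \<sigma>: "strict_mono \<sigma>" and x: "(?X \<circ> \<sigma>) \<longlonglongrightarrow> x" and \<tau>: "strict_mono \<tau>" and y: "(?X \<circ> \<tau>) \<longlonglongrightarrow> y"
    for \<sigma> \<tau> x y a
  proof (rule ccontr)
    assume less: "\<not> ?thesis"
    note X = limit_point[OF \<sigma> x] and Y = limit_point[OF \<tau> y]
    have a: "a \<in> B" using less X Y by fastforce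
    have sumB: "(\<Sum>b\<in>B. z $ b) = 1"
      if "(\<Sum>b\<in>UNIV. z $ b) = 1" "\<forall>b. b \<notin> B \<longrightarrow> z $ b = 0" for z :: "real ^ 'a"
    proof -
      have "(\<Sum>b\<in>B. z $ b) = (\<Sum>b\<in>UNIV. z $ b)"
        using that by (intro sum.mono_neutral_left) auto
      then show ?thesis using that by simp
    qed
    \<comment> \<open>If B contains a second action, both probabilities are below 1 and g is continuous at them.\<close>
    have "y $ b \<le> x $ b" if b: "b \<in> B" for b
    proof (cases "b = a")
      case True
      then show ?thesis using less by simp
    next
      case False
      have inner: "z $ a \<in> {0<..<1} \<and> z $ b \<in> {0<..<1}"
        if z: "(\<forall>a. 0 \<le> z $ a)" "(\<Sum>a\<in>UNIV. z $ a) = 1" "\<forall>a\<in>B. 0 < z $ a" for z :: "real ^ 'a"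
      proof -
        have "(\<Sum>c\<in>{a, b}. z $ c) \<le> (\<Sum>c\<in>UNIV. z $ c)"
          using z by (intro sum_mono2) auto
        then have "z $ a + z $ b \<le> 1" using z False by simp
        moreover have "0 < z $ a" "0 < z $ b" using z a b by auto
        ultimately show ?thesis by auto
      qed
      have ix: "x $ a \<in> {0<..<1}" "x $ b \<in> {0<..<1}" and iy: "y $ a \<in> {0<..<1}" "y $ b \<in> {0<..<1}"
        using inner[of x] inner[of y] X Y by blast+
      obtain c where c: "(\<lambda>k. g (pmf (p k) b) - g (pmf (p k) a)) \<longlonglongrightarrow> c"
        using conv[OF b a] by (auto simp: convergent_def)
      have diff: "g (z $ b) - g (z $ a) = c"
        if "strict_mono \<rho>" "z $ a \<in> {0<..<1}" "z $ b \<in> {0<..<1}" "\<forall>a. (\<lambda>k. pmf (p (\<rho> k)) a) \<longlonglongrightarrow> z $ a"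
        for \<rho> and z :: "real ^ 'a"
      proof (rule LIMSEQ_unique)
        show "(\<lambda>k. g (pmf (p (\<rho> k)) b) - g (pmf (p (\<rho> k)) a)) \<longlonglongrightarrow> g (z $ b) - g (z $ a)"
          using that by (intro tendsto_diff isCont_tendsto_compose[OF isCont_g]) auto
        show "(\<lambda>k. g (pmf (p (\<rho> k)) b) - g (pmf (p (\<rho> k)) a)) \<longlonglongrightarrow> c"
          using LIMSEQ_subseq_LIMSEQ[OF c that(1)] by (simp add: comp_def)
      qed
      have "g (x $ b) - g (x $ a) = g (y $ b) - g (y $ a)"
        using diff[OF \<sigma> ix] diff[OF \<tau> iy] X Y by simp
      moreover have "g (y $ a) < g (x $ a)"
        using less by (intro g_strict_mono ix iy) simp
      ultimately have "g (y $ b) < g (x $ b)" by linarith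
      then show ?thesis using ix iy by (simp add: g_less_iff)
    qed
    moreover have "y $ a < x $ a" using less by simp
    ultimately have "(\<Sum>b\<in>B. y $ b) < (\<Sum>b\<in>B. x $ b)"
      using a by (intro sum_strict_mono_ex1) auto
    then show False using sumB[of x] sumB[of y] X Y by simp
  qed
  have "bounded (range ?X)"
  proof (rule boundedI)
    fix v assume "v \<in> range ?X"
    then obtain k where "v = prob_vec (p k)" by blast
    then show "norm v \<le> real CARD('a)"
      using norm_le_l1_cart[of v] sum_bounded_above[of UNIV "\<lambda>a. \<bar>v $ a\<bar>" 1]
      by (auto simp: prob_vec_def pmf_le_1)
  qed
  then have "convergent ?X"
    by (rule convergent_if_unique_subsequential_limit) (metis antisym le vec_eq_iff)
  then obtain x where x: "?X \<longlonglongrightarrow> x" by (auto simp: convergent_def)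
  then have "(?X \<circ> id) \<longlonglongrightarrow> x" by simp
  note X = limit_point[OF strict_mono_id this]
  then obtain q where q: "\<And>a. pmf q a = x $ a"
    using obtain_pmf_of_finite_type[of "\<lambda>a. x $ a"] by blast
  have "prob_vec q = x" by (simp add: prob_vec_def q vec_eq_iff)
  then show ?thesis using that[of q] x X q by simp
qed

end

section \<open>Convergence of policy mirror descent\<close>

lemma marginal_gap_converges:
  fixes u :: "nat \<Rightarrow> real"
  assumes step: "\<And>k. u (Suc k) - u k = \<eta> * (A k - B k)" and "summable e"
    and "\<And>k. \<bar>A k - B k\<bar> \<le> e k"
  shows "convergent u"
proof -
  have "summable (\<lambda>k. A k - B k)"
    using assms(2,3) by (intro summable_comparison_test'[OF \<open>summable e\<close>, where N=0]) simp
  then have "summable (\<lambda>k. u (Suc k) - u k)"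
    unfolding step by (rule summable_mult)
  then have "convergent (\<lambda>n. \<Sum>k<n. u (Suc k) - u k)"
    by (simp add: summable_iff_convergent)
  then have "convergent (\<lambda>n. u n - u 0)"
    by (simp add: sum_lessThan_telescope)
  then show ?thesis
    using convergent_add[OF _ convergent_const, of "\<lambda>n. u n - u 0" "u 0"] by simp
qed

lemma marginal_gap_diverges:
  fixes u :: "nat \<Rightarrow> real"
  assumes step: "\<And>k. u (Suc k) - u k = \<eta> * (A k - B k)" and "0 < \<eta>" and "summable e"
    and "0 < \<Delta>" and gap: "\<And>k. A k - B k \<le> e k - \<Delta>" and e: "\<And>k. 0 \<le> e k"
  shows "filterlim u at_bot sequentially"
proof -
  \<comment> \<open>The errors e contribute at most their total sum; the drift is linear in n.\<close>
  have bound: "u n \<le> u 0 + \<eta> * suminf e - \<eta> * \<Delta> * real n" for n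
  proof -
    have "u n - u 0 = (\<Sum>k<n. u (Suc k) - u k)"
      by (simp add: sum_lessThan_telescope)
    also have "\<dots> \<le> (\<Sum>k<n. \<eta> * (e k - \<Delta>))"
      unfolding step using \<open>0 < \<eta>\<close> gap by (intro sum_mono mult_left_mono) auto
    also have "\<dots> = \<eta> * (\<Sum>k<n. e k) - \<eta> * \<Delta> * real n"
      by (simp add: sum_distrib_left[symmetric] sum_subtractf algebra_simps)
    also have "\<dots> \<le> \<eta> * suminf e - \<eta> * \<Delta> * real n"
      using \<open>0 < \<eta>\<close> e by (intro diff_right_mono mult_left_mono sum_le_suminf \<open>summable e\<close>) auto
    finally show ?thesis by simp
  qed
  show ?thesis
    unfolding filterlim_at_bot
  proof
    fix z
    obtain N :: nat where N: "(u 0 + \<eta> * suminf e - z) / (\<eta> * \<Delta>) \<le> real N"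
      using real_arch_simple by blast
    have "u n \<le> z" if "N \<le> n" for n
    proof -
      have "(u 0 + \<eta> * suminf e - z) / (\<eta> * \<Delta>) \<le> real n" using N that by linarith
      then have "u 0 + \<eta> * suminf e - z \<le> \<eta> * \<Delta> * real n"
        using \<open>0 < \<eta>\<close> \<open>0 < \<Delta>\<close> by (simp add: pos_divide_le_eq mult.commute)
      then show ?thesis using bound[of n] by linarith
    qed
    then show "eventually (\<lambda>n. u n \<le> z) sequentially"
      unfolding eventually_sequentially by blast
  qed
qed

theorem theorem3p18:
  fixes P :: "'s::finite \<Rightarrow> 'a::finite \<Rightarrow> 's pmf"
    and r :: "'s \<Rightarrow> 'a \<Rightarrow> real"
    and \<gamma> \<eta> :: real
    and \<psi> :: "real \<Rightarrow> ereal"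
    and \<pi> :: "nat \<Rightarrow> 's \<Rightarrow> 'a pmf"
  assumes mdp: "finite_discounted_mdp P r \<gamma>"
    and nontrivial: "nontrivial_states P r \<gamma> \<noteq> {}"
    and mirror: "mirror_map \<psi>"
    and step_pos: "\<eta> > 0"
    and init: "\<forall>s a. pmf (\<pi> 0 s) a \<in> interior (eff_dom \<psi>)"
    and pmd: "pmd_iterates P r \<gamma> \<psi> \<eta> \<pi>"
    and deriv_0: "filterlim (ereal_deriv \<psi>) at_bot (at_right 0)"
    and deriv_1: "filterlim (ereal_deriv \<psi>) at_top (at_left 1)"
  shows "summable (\<lambda>k. sup_norm (\<lambda>s. opt_value P r \<gamma> s - value_fun P r \<gamma> (\<pi> k) s)) \<and>
    (\<exists>\<pi>_lim \<in> opt_policies P r \<gamma>.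
      (\<forall>s. (\<lambda>k. prob_vec (\<pi> k s)) \<longlonglongrightarrow> prob_vec (\<pi>_lim s)) \<and>
      (\<forall>s. \<forall>a'. a' \<notin> opt_actions P r \<gamma> s \<longrightarrow> pmf (\<pi>_lim s) a' = 0) \<and>
      (\<forall>s\<in>states_unique_opt P r \<gamma>. \<forall>a\<in>opt_actions P r \<gamma> s. pmf (\<pi>_lim s) a = 1) \<and>
      (\<forall>s\<in>states_multiple_opt P r \<gamma>. \<forall>a\<in>opt_actions P r \<gamma> s.
         pmf (\<pi>_lim s) a \<in> interior (eff_dom \<psi>)))"
proof -
  interpret M: steep_mirror_map \<psi>
    by unfold_locales (rule mirror deriv_0 deriv_1)+
  interpret D: discounted_mdp P r \<gamma>
    by unfold_locales (rule mdp)
  let ?V = "\<lambda>k. value_fun P r \<gamma> (\<pi> k)" and ?Q = "\<lambda>k. q_fun P r \<gamma> (\<pi> k)"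
  have inside: "pmf (\<pi> k s) a \<in> {0<..<1}" for k s a
  proof (induction k arbitrary: a)
    case 0
    then show ?case using init by (simp add: M.interior_dom_eq)
  next
    case (Suc k)
    then show ?case
      using pmd M.mirror_step_optimality(1) unfolding pmd_iterates_def by blast
  qed
  have kkt: "\<eta> * ?Q k s a + M.g (pmf (\<pi> k s) a) - M.g (pmf (\<pi> (Suc k) s) a)
      = \<eta> * ?Q k s b + M.g (pmf (\<pi> k s) b) - M.g (pmf (\<pi> (Suc k) s) b)" for k s a b
    using pmd M.mirror_step_optimality(2)[OF inside] unfolding pmd_iterates_def by blast
  let ?D = "\<lambda>p q. M.divergence (pmf p) (pmf q)"
  have backup: "policy_backup P r \<gamma> \<rho> (?V k) s = (\<Sum>a\<in>UNIV. pmf (\<rho> s) a * ?Q k s a)" for \<rho> k s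
    by (simp add: policy_backup_def q_fun_eq_backup[OF mdp])
  \<comment> \<open>This identity serves twice: with the current policy it shows improvement, with an optimal one
    it bounds the regret by the decrease of the divergence.\<close>
  have gain: "\<eta> * (policy_backup P r \<gamma> \<rho> (?V k) s - policy_backup P r \<gamma> (\<pi> (Suc k)) (?V k) s)
      = ?D (\<rho> s) (\<pi> k s) - ?D (\<rho> s) (\<pi> (Suc k) s) - ?D (\<pi> (Suc k) s) (\<pi> k s)" for \<rho> k s
    unfolding backup by (rule M.mirror_step_gain) (rule kkt)
  have D_nonneg: "0 \<le> ?D p (\<pi> k s)" for p k s
    using inside by (intro M.divergence_nonneg) (auto simp: pmf_le_1)
  obtain \<rho> where \<rho>: "\<rho> \<in> opt_policies P r \<gamma>"
    using D.opt_policies_nonempty by blast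
  define e where "e k = sup_norm (\<lambda>s. opt_value P r \<gamma> s - ?V k s)" for k
  have "summable (\<lambda>k. sup_norm (\<lambda>s. opt_value P r \<gamma> s - ?V k s))"
  proof (rule D.summable_value_errors[OF \<rho>, where D="\<lambda>k s. ?D (\<rho> s) (\<pi> k s) / \<eta>"])
    fix k s
    have "M.divergence (pmf (\<pi> k s)) (pmf (\<pi> k s)) = 0"
      by (simp add: M.divergence_def)
    then have "\<eta> * (?V k s - policy_backup P r \<gamma> (\<pi> (Suc k)) (?V k) s) \<le> 0"
      using gain[of "\<pi> k" k s] D_nonneg[of "\<pi> k s" "Suc k" s] D_nonneg[of "\<pi> (Suc k) s" k s]
      by (simp add: D.value_fun_fixpoint[symmetric])
    then show "?V k s \<le> policy_backup P r \<gamma> (\<pi> (Suc k)) (?V k) s"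
      using step_pos by (simp add: mult_le_0_iff)
    show "policy_backup P r \<gamma> \<rho> (?V k) s - policy_backup P r \<gamma> (\<pi> (Suc k)) (?V k) s
        \<le> ?D (\<rho> s) (\<pi> k s) / \<eta> - ?D (\<rho> s) (\<pi> (Suc k) s) / \<eta>"
      using gain[of \<rho> k s] D_nonneg[of "\<pi> (Suc k) s" k s] step_pos
      by (simp add: field_simps)
    show "0 \<le> ?D (\<rho> s) (\<pi> k s) / \<eta>"
      using D_nonneg step_pos by simp
  qed
  then have sum_e: "summable e" by (simp add: e_def[abs_def])
  have q_le: "?Q k s a \<le> opt_q P r \<gamma> s a" for k s a
    by (rule D.q_error_bounds)
  have q_gap: "opt_q P r \<gamma> s a - ?Q k s a \<le> e k" for k s a
    unfolding e_def by (rule D.q_error_bounds)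
  have e_nonneg: "0 \<le> e k" for k
    using q_le[of k undefined undefined] q_gap[of undefined undefined k] by linarith
  \<comment> \<open>The Lagrange multiplier cancels in the gap between two actions, so the gap accumulates the
    differences of the Q-values. These are summable if both actions are optimal, and at most e k minus a
    positive constant if only b is.\<close>
  have gap_step: "(M.g (pmf (\<pi> (Suc k) s) a) - M.g (pmf (\<pi> (Suc k) s) b))
      - (M.g (pmf (\<pi> k s) a) - M.g (pmf (\<pi> k s) b)) = \<eta> * (?Q k s a - ?Q k s b)" for k s a b
    using kkt[of k s a b] by (simp add: algebra_simps)
  have "\<exists>q. (\<lambda>k. prob_vec (\<pi> k s)) \<longlonglongrightarrow> prob_vec q \<and>
      (\<forall>a. a \<notin> opt_actions P r \<gamma> s \<longrightarrow> pmf q a = 0) \<and>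
      (\<forall>a\<in>opt_actions P r \<gamma> s. 0 < pmf q a)" for s
  proof (rule M.policy_sequence_converges[OF inside D.opt_actions_nonempty])
    fix a b assume a: "a \<notin> opt_actions P r \<gamma> s" and b: "b \<in> opt_actions P r \<gamma> s"
    define \<Delta> where "\<Delta> = opt_value P r \<gamma> s - opt_q P r \<gamma> s a"
    have "0 < \<Delta>"
      using a D.opt_q_le_opt_value[of s a] by (simp add: \<Delta>_def opt_actions_def)
    moreover have "?Q k s a - ?Q k s b \<le> e k - \<Delta>" for k
      using q_le[of k s a] q_gap[of s b k] b
      by (simp add: \<Delta>_def opt_actions_def)
    ultimately show "filterlim (\<lambda>k. M.g (pmf (\<pi> k s) a) - M.g (pmf (\<pi> k s) b)) at_bot sequentially"
      using gap_step[of _ s a b] step_pos sum_e e_nonneg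
      by (intro marginal_gap_diverges[where A="\<lambda>k. ?Q k s a" and B="\<lambda>k. ?Q k s b"
            and \<eta>=\<eta> and e=e and \<Delta>=\<Delta>]) assumption+
  next
    fix a b assume a: "a \<in> opt_actions P r \<gamma> s" and b: "b \<in> opt_actions P r \<gamma> s"
    have "\<bar>?Q k s a - ?Q k s b\<bar> \<le> e k" for k
      using q_le[of k s a] q_gap[of s a k] q_le[of k s b] q_gap[of s b k] a b by (simp add: opt_actions_def)
    then show "convergent (\<lambda>k. M.g (pmf (\<pi> k s) a) - M.g (pmf (\<pi> k s) b))"
      using gap_step[of _ s a b] sum_e
      by (intro marginal_gap_converges[where A="\<lambda>k. ?Q k s a" and B="\<lambda>k. ?Q k s b"
            and \<eta>=\<eta> and e=e]) assumption+
  qed blast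
  then obtain \<pi>_lim where lim: "\<And>s. (\<lambda>k. prob_vec (\<pi> k s)) \<longlonglongrightarrow> prob_vec (\<pi>_lim s)"
    and zero: "\<And>s a. a \<notin> opt_actions P r \<gamma> s \<Longrightarrow> pmf (\<pi>_lim s) a = 0"
    and pos: "\<And>s a. a \<in> opt_actions P r \<gamma> s \<Longrightarrow> 0 < pmf (\<pi>_lim s) a"
    by metis
  have unique: "pmf (\<pi>_lim s) a = 1"
    if "s \<in> states_unique_opt P r \<gamma>" "a \<in> opt_actions P r \<gamma> s" for s a
  proof (rule pmf_of_unique_support)
    have "card (opt_actions P r \<gamma> s) = 1"
      using that(1) unfolding states_unique_opt_def by (rule CollectD)
    then obtain c where "opt_actions P r \<gamma> s = {c}"
      by (rule card_1_singletonE)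
    then show "pmf (\<pi>_lim s) b = 0" if "b \<noteq> a" for b
      using that zero \<open>a \<in> opt_actions P r \<gamma> s\<close> by auto
  qed
  have multiple: "pmf (\<pi>_lim s) a \<in> interior (eff_dom \<psi>)"
    if s: "s \<in> states_multiple_opt P r \<gamma>" and a: "a \<in> opt_actions P r \<gamma> s" for s a
  proof -
    have "opt_actions P r \<gamma> s \<noteq> {a}"
      using s by (auto simp: states_multiple_opt_def)
    then obtain b where b: "b \<in> opt_actions P r \<gamma> s" "b \<noteq> a"
      using a by blast
    then show ?thesis
      using pos[OF a] pos[OF b(1)] pmf_add_le_1[of b a "\<pi>_lim s"] by (simp add: M.interior_dom_eq)
  qed
  have "\<pi>_lim \<in> opt_policies P r \<gamma>"
    by (rule D.supported_on_opt_actions_imp_optimal) (rule zero)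
  then show ?thesis
    using sum_e lim zero unique multiple unfolding e_def[abs_def] by blast
qed

end
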